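(* Let $\varphi$ be a surjective symbol for $S(\mathbb{R})$ such that $C_{\varphi}:S(\mathbb{R})\to S(\mathbb{R})$, $f\mapsto f\circ\varphi$, has closed range. Assume that there exists $k$ such that $\varphi'(x)\neq 0$ if $|x|>k$. Then there exists a closed unbounded interval $I\subset\mathbb{R}$ such that the continuous linear mapping $C_{\varphi}:S(\varphi(I))\to S(I)$, $f\mapsto f\circ\varphi|_I$, is surjective. Moreover, the multiplication operator $M_{\varphi'}:S(I)\to S(I)$, $f\mapsto \varphi' f$, is well defined and it has closed range of codimension less than or equal to $1$.
   Context: All functions are real-valued. For $I=\mathbb{R}$ or $I\subset\mathbb{R}$ a closed unbounded interval (such as $[a,+\infty)$ or $(-\infty,a]$), $S(I)$ is the space of functions $f\in C^\infty(I)$ (with one-sided derivatives at a finite endpoint) such that $\sup_{x\in I}\sup_{0\leq j\leq n}(1+x^2)^n|f^{(j)}(x)|<\infty$ for each $n\in\mathbb{N}$, endowed with the Fréchet topology generated by these seminorms; $S(\mathbb{R})$ is the (real) Schwartz space. A function $\varphi\in C^\infty(\mathbb{R})$ is called a symbol for $S(\mathbb{R})$ if $f\circ\varphi\in S(\mathbb{R})$ whenever $f\in S(\mathbb{R})$. Every symbol satisfies $|\varphi(x)|\to\infty$ as $|x|\to\infty$, so $\varphi(I)$ is again a closed unbounded interval. In $M_{\varphi'}:S(I)\to S(I)$ the function $\varphi'$ is restricted to $I$, and "well defined" means $\varphi' f\in S(I)$ for every $f\in S(I)$. An operator has closed range if its image is a closed subset of the target space. *)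

theory Defs
  imports "HOL-Analysis.Analysis"
begin

text \<open>The derivatives are taken within \<open>I\<close>, so they are one-sided at a finite endpoint of
  \<open>I\<close>.  They are meaningful at the points of \<open>I\<close> only, for an interval \<open>I\<close> with nonempty
  interior.\<close>

primrec nth_deriv_on :: "real set \<Rightarrow> nat \<Rightarrow> (real \<Rightarrow> real) \<Rightarrow> real \<Rightarrow> real" where
  "nth_deriv_on I 0 f = f"
| "nth_deriv_on I (Suc n) f = (\<lambda>x. vector_derivative (nth_deriv_on I n f) (at x within I))"

definition smooth_on :: "real set \<Rightarrow> (real \<Rightarrow> real) \<Rightarrow> bool" where
  "smooth_on I f \<longleftrightarrow> (\<forall>n. nth_deriv_on I n f differentiable_on I)"

definition half_line :: "real set \<Rightarrow> bool" where
  "half_line I \<longleftrightarrow> (\<exists>a. I = {a..} \<or> I = {..a})"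

definition schwartz_values :: "real set \<Rightarrow> nat \<Rightarrow> (real \<Rightarrow> real) \<Rightarrow> real set" where
  "schwartz_values I n f = {(1 + x\<^sup>2) ^ n * \<bar>nth_deriv_on I j f x\<bar> | x j. x \<in> I \<and> j \<le> n}"

definition schwartz_seminorm :: "real set \<Rightarrow> nat \<Rightarrow> (real \<Rightarrow> real) \<Rightarrow> real" where
  "schwartz_seminorm I n f = Sup (schwartz_values I n f)"

text \<open>A function on \<open>I\<close> is represented by its extension by \<open>0\<close> to the whole line. Hence two
  elements of \<open>schwartz I\<close> are equal iff they agree on \<open>I\<close>, and \<open>schwartz I\<close> is closed under
  pointwise linear combinations. No regularity of the extension across an endpoint is
  required.\<close>

definition schwartz :: "real set \<Rightarrow> (real \<Rightarrow> real) set" where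
  "schwartz I = {f. smooth_on I f \<and> (\<forall>n. bdd_above (schwartz_values I n f)) \<and>
                    (\<forall>x. x \<notin> I \<longrightarrow> f x = 0)}"

definition schwartz_topology :: "real set \<Rightarrow> (real \<Rightarrow> real) topology" where
  "schwartz_topology I = topology_generated_by
     {{g \<in> schwartz I. schwartz_seminorm I n (\<lambda>x. g x - f x) < e} | f n e. f \<in> schwartz I \<and> e > 0}"

definition schwartz_symbol :: "(real \<Rightarrow> real) \<Rightarrow> bool" where
  "schwartz_symbol \<phi> \<longleftrightarrow> smooth_on UNIV \<phi> \<and> (\<forall>f \<in> schwartz UNIV. f \<circ> \<phi> \<in> schwartz UNIV)"

definition composition_operator :: "(real \<Rightarrow> real) \<Rightarrow> real set \<Rightarrow> (real \<Rightarrow> real) \<Rightarrow> real \<Rightarrow> real" where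
  "composition_operator \<phi> I f = (\<lambda>x. if x \<in> I then f (\<phi> x) else 0)"

text \<open>No restriction of the multiplier \<open>h\<close> to \<open>I\<close> is needed, since \<open>f\<close> vanishes off \<open>I\<close>.\<close>

definition multiplication_operator :: "(real \<Rightarrow> real) \<Rightarrow> (real \<Rightarrow> real) \<Rightarrow> real \<Rightarrow> real" where
  "multiplication_operator h f = (\<lambda>x. h x * f x)"

definition continuous_linear_map ::
  "real set \<Rightarrow> real set \<Rightarrow> ((real \<Rightarrow> real) \<Rightarrow> real \<Rightarrow> real) \<Rightarrow> bool" where
  "continuous_linear_map J I T \<longleftrightarrow>
     continuous_map (schwartz_topology J) (schwartz_topology I) T \<and>
     (\<forall>f \<in> schwartz J. \<forall>g \<in> schwartz J. \<forall>c d.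
        T (\<lambda>x. c * f x + d * g x) = (\<lambda>x. c * T f x + d * T g x))"

text \<open>For a linear subspace \<open>W\<close> of a space \<open>V\<close> of functions, \<open>has_codimension V W n\<close> says that
  the quotient \<open>V/W\<close> has a basis of \<open>n\<close> elements, namely the classes of \<open>b 0 to b (n - 1)\<close>.\<close>

definition has_codimension :: "(real \<Rightarrow> real) set \<Rightarrow> (real \<Rightarrow> real) set \<Rightarrow> nat \<Rightarrow> bool" where
  "has_codimension V W n \<longleftrightarrow>
     (\<exists>b. (\<forall>i<n. b i \<in> V) \<and>
          (\<forall>f \<in> V. \<exists>!c. c \<in> {..<n} \<rightarrow>\<^sub>E UNIV \<and> (\<lambda>x. f x - (\<Sum>i<n. c i * b i x)) \<in> W))"

end

theory Submission
  imports Defs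
begin

text \<open>Since \<open>\<phi>\<close> is onto and monotone on both tails, on \<open>I = [a, \<infinity>)\<close> with \<open>a\<close> large it is a
  diffeomorphism onto a half-line \<open>J\<close>, and no point outside \<open>I\<close> is mapped into \<open>J\<close>.

  The coefficients in the Faa di Bruno formula for \<open>f \<circ> \<phi>\<close>, times any power of \<open>1 + x\<^sup>2\<close>, are
  bounded on \<open>I\<close> by a power of \<open>1 + \<phi>(x)\<^sup>2\<close>: otherwise a sum of widely separated bumps, one near
  each point \<open>\<phi>(x\<^sub>m)\<close> where the bound fails, is a Schwartz function whose composition with
  \<open>\<phi>\<close> is not. This makes the composition operator from \<open>S(J)\<close> to \<open>S(I)\<close> continuous.

  For its surjectivity let \<open>g \<in> S(I)\<close>. Cutting \<open>g\<close> off near \<open>a\<close> gives a limit of compactly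
  supported functions, each of which lies in the range of the composition operator on \<open>S(\<real>)\<close>.
  As this range is closed, it contains the limit, so \<open>g \<circ> \<phi>\<^sup>-\<^sup>1\<close> coincides near infinity with a
  Schwartz function on the line.

  Differentiation maps the Schwartz space of a half-line onto itself, so the identity
  \<open>(A \<circ> \<phi>)' = \<phi>' (A' \<circ> \<phi>)\<close> shows that multiplication by \<open>\<phi>'\<close> is well defined on \<open>S(I)\<close> and
  even onto: the codimension is \<open>0\<close>.\<close>

subsection \<open>Iterated derivatives within a set\<close>

text \<open>No point of the set is isolated, which makes a derivative within the set unique. The
  line and the half-lines are thereby treated together.\<close>

definition perfect_set :: "real set \<Rightarrow> bool" where
  "perfect_set I \<longleftrightarrow> (\<forall>x\<in>I. at x within I \<noteq> bot)"

lemma perfect_set_UNIV [simp]: "perfect_set UNIV"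
  by (simp add: perfect_set_def)

lemma perfect_set_half_line: "half_line I \<Longrightarrow> perfect_set I"
proof -
  have "x islimpt {a..}" if "a \<le> x" for a x :: real
    using islimpt_subset[of x "{x..x+1}" "{a..}"] that by auto
  moreover have "x islimpt {..a}" if "x \<le> a" for a x :: real
    using islimpt_subset[of x "{x-1..x}" "{..a}"] that by auto
  ultimately show "half_line I \<Longrightarrow> perfect_set I"
    by (auto simp: half_line_def perfect_set_def trivial_limit_within)
qed

lemma nth_deriv_on_Suc_eq:
  assumes "perfect_set I" "x \<in> I" "(nth_deriv_on I n f has_field_derivative d) (at x within I)"
  shows "nth_deriv_on I (Suc n) f x = d"
  using assms
  by (auto simp: perfect_set_def has_real_derivative_iff_has_vector_derivative
      intro!: vector_derivative_within)

text \<open>Uniqueness of derivatives identifies any guessed sequence, in which each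
  \<open>F (Suc n)\<close> is the derivative of \<open>F n\<close>, with the iterated derivatives.
  Most later formulas for n-th derivatives are verified in this way.\<close>

lemma smooth_on_sequence:
  assumes I: "perfect_set I"
    and 0: "\<And>x. x \<in> I \<Longrightarrow> f x = F 0 x"
    and D: "\<And>n x. x \<in> I \<Longrightarrow> (F n has_field_derivative F (Suc n) x) (at x within I)"
  shows "smooth_on I f" and "x \<in> I \<Longrightarrow> nth_deriv_on I n f x = F n x"
proof -
  have *: "\<forall>x\<in>I. nth_deriv_on I n f x = F n x" for n
  proof (induction n)
    case (Suc n)
    have "(nth_deriv_on I n f has_field_derivative F (Suc n) x) (at x within I)" if "x \<in> I" for x
      by (rule has_field_derivative_transform_within[OF D[OF that, of n] zero_less_one])
        (use that Suc in auto)
    then show ?case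
      using nth_deriv_on_Suc_eq[OF I] by blast
  qed (simp add: 0)
  then show "x \<in> I \<Longrightarrow> nth_deriv_on I n f x = F n x" by blast
  have "(nth_deriv_on I n f has_field_derivative F (Suc n) x) (at x within I)" if "x \<in> I" for n x
    by (rule has_field_derivative_transform_within[OF D[OF that, of n] zero_less_one])
      (use that * in auto)
  then show "smooth_on I f"
    unfolding smooth_on_def
    by (meson differentiable_on_def field_differentiable_def field_differentiable_imp_differentiable)
qed

text \<open>For use when no closed form of the n-th derivative is at hand: choosing for each member
  a derivative inside the family and iterating the choice gives a sequence for
  \<open>smooth_on_sequence\<close>.\<close>

lemma smooth_on_family:
  assumes I: "perfect_set I"
    and D: "\<And>f. f \<in> \<F> \<Longrightarrow> \<exists>g\<in>\<F>. \<forall>x\<in>I. (f has_field_derivative g x) (at x within I)"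
    and f: "f \<in> \<F>"
  shows "smooth_on I f" and "\<exists>g\<in>\<F>. \<forall>x\<in>I. nth_deriv_on I n f x = g x"
proof -
  obtain d where d: "\<And>f. f \<in> \<F> \<Longrightarrow> d f \<in> \<F>"
      "\<And>f x. \<lbrakk>f \<in> \<F>; x \<in> I\<rbrakk> \<Longrightarrow> (f has_field_derivative d f x) (at x within I)"
    using D by metis
  define F where "F n = (d ^^ n) f" for n
  have F: "F n \<in> \<F>" for n
    by (induction n) (auto simp: F_def f d)
  have "smooth_on I f" and *: "\<forall>x\<in>I. nth_deriv_on I n f x = F n x"
    using smooth_on_sequence[OF I, of f F] d(2)[OF F] by (auto simp: F_def)
  then show "smooth_on I f" "\<exists>g\<in>\<F>. \<forall>x\<in>I. nth_deriv_on I n f x = g x"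
    using F by blast+
qed

lemma smooth_on_nth_deriv:
  assumes "perfect_set I" "smooth_on I f" "x \<in> I"
  shows "(nth_deriv_on I n f has_field_derivative nth_deriv_on I (Suc n) f x) (at x within I)"
proof -
  have "nth_deriv_on I n f differentiable (at x within I)"
    using assms by (auto simp: smooth_on_def differentiable_on_def)
  then show ?thesis
    by (simp add: has_real_derivative_iff_has_vector_derivative vector_derivative_works)
qed

lemma smooth_on_field_derivative:
  assumes "perfect_set I" "smooth_on I f" "x \<in> I"
  shows "(f has_field_derivative nth_deriv_on I 1 f x) (at x within I)"
  using smooth_on_nth_deriv[OF assms, of 0] by simp

lemma nth_deriv_on_add: "nth_deriv_on I n (nth_deriv_on I m f) = nth_deriv_on I (n + m) f"
  by (induction n) auto

lemma smooth_on_deriv: "smooth_on I f \<Longrightarrow> smooth_on I (nth_deriv_on I m f)"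
  by (simp add: smooth_on_def nth_deriv_on_add)

lemma continuous_on_nth_deriv: "smooth_on I f \<Longrightarrow> continuous_on I (nth_deriv_on I n f)"
  by (auto simp: smooth_on_def intro: differentiable_imp_continuous_on)

lemma smooth_on_continuous: "smooth_on I f \<Longrightarrow> continuous_on I f"
  using continuous_on_nth_deriv[of I f 0] by simp

lemma smooth_on_const: "perfect_set I \<Longrightarrow> smooth_on I (\<lambda>x. c)"
  by (rule smooth_on_family(1)[where \<F> = "range (\<lambda>c x. c)"])
    (auto intro!: derivative_eq_intros)

lemma smooth_on_ident: "perfect_set I \<Longrightarrow> smooth_on I (\<lambda>x. x)"
  by (rule smooth_on_family(1)[where \<F> = "insert (\<lambda>x. x) (range (\<lambda>c x. c))"])
    (auto intro!: derivative_eq_intros)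

lemma
  assumes "perfect_set I" "smooth_on I f" "\<And>x. x \<in> I \<Longrightarrow> g x = f x"
  shows smooth_on_cong: "smooth_on I g"
    and nth_deriv_on_cong: "x \<in> I \<Longrightarrow> nth_deriv_on I n g x = nth_deriv_on I n f x"
  using smooth_on_sequence[of I g "\<lambda>n. nth_deriv_on I n f"] smooth_on_nth_deriv[OF assms(1,2)]
    assms by auto

lemma
  assumes "perfect_set I" "smooth_on I f" "smooth_on I g"
  shows smooth_on_lincomb: "smooth_on I (\<lambda>x. c * f x + d * g x)"
    and nth_deriv_on_lincomb: "x \<in> I \<Longrightarrow> nth_deriv_on I n (\<lambda>x. c * f x + d * g x) x
           = c * nth_deriv_on I n f x + d * nth_deriv_on I n g x"
  by (rule smooth_on_sequence[of I "\<lambda>x. c * f x + d * g x"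
        "\<lambda>n x. c * nth_deriv_on I n f x + d * nth_deriv_on I n g x"];
      auto intro!: derivative_eq_intros smooth_on_nth_deriv[unfolded nth_deriv_on.simps] assms)+

lemma smooth_on_add:
  assumes "perfect_set I" "smooth_on I f" "smooth_on I g"
  shows "smooth_on I (\<lambda>x. f x + g x)"
  using smooth_on_lincomb[OF assms, of 1 1] by simp

lemma
  assumes I: "perfect_set I" and f: "smooth_on I f" and g: "smooth_on I g"
  shows smooth_on_mult: "smooth_on I (\<lambda>x. f x * g x)"
    and nth_deriv_on_mult: "x \<in> I \<Longrightarrow> nth_deriv_on I n (\<lambda>x. f x * g x) x
      = (\<Sum>k\<le>n. of_nat (n choose k) * (nth_deriv_on I k f x * nth_deriv_on I (n - k) g x))"
proof -
  define F where "F n x =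
    (\<Sum>k\<le>n. of_nat (n choose k) * (nth_deriv_on I k f x * nth_deriv_on I (n - k) g x))" for n x
  have "(F n has_field_derivative F (Suc n) x) (at x within I)" if x: "x \<in> I" for n x
  proof -
    let ?a = "\<lambda>k. nth_deriv_on I k f x" and ?b = "\<lambda>k. nth_deriv_on I k g x"
    have "(F n has_field_derivative (\<Sum>k\<le>n. of_nat (n choose k) *
        (?a (Suc k) * ?b (n - k) + ?a k * ?b (Suc (n - k))))) (at x within I)"
      unfolding F_def
      by (rule DERIV_sum, rule DERIV_cmult, rule DERIV_cong[OF DERIV_mult'
            [OF smooth_on_nth_deriv[OF I f x] smooth_on_nth_deriv[OF I g x]]]) (simp add: add.commute)
    also have "(\<Sum>k\<le>n. of_nat (n choose k) *
        (?a (Suc k) * ?b (n - k) + ?a k * ?b (Suc (n - k)))) =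
        (\<Sum>k\<le>n. of_nat (n choose k) * (?a (Suc k) * ?b (Suc n - Suc k))) +
        (\<Sum>k\<le>n. of_nat (n choose k) * (?a k * ?b (Suc n - k)))"
      by (simp add: Suc_diff_le sum.distrib distrib_left)
    \<comment> \<open>The extra summand at k = n + 1 has binomial coefficient 0. After an index
      shift, Pascal's rule merges the two sums.\<close>
    also have "(\<Sum>k\<le>n. of_nat (n choose k) * (?a k * ?b (Suc n - k))) =
        (\<Sum>k\<le>Suc n. of_nat (n choose k) * (?a k * ?b (Suc n - k)))"
      by simp
    also have "\<dots> = ?a 0 * ?b (Suc n) +
        (\<Sum>k\<le>n. of_nat (n choose Suc k) * (?a (Suc k) * ?b (Suc n - Suc k)))"
      by (subst sum.atMost_Suc_shift) simp
    also have "(\<Sum>k\<le>n. of_nat (n choose k) * (?a (Suc k) * ?b (Suc n - Suc k))) + \<dots> = F (Suc n) x"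
      unfolding F_def sum.atMost_Suc_shift[of _ n]
      by (simp add: sum.distrib distrib_right del: nth_deriv_on.simps)
    finally show ?thesis .
  qed
  then show "smooth_on I (\<lambda>x. f x * g x)"
    and "x \<in> I \<Longrightarrow> nth_deriv_on I n (\<lambda>x. f x * g x) x
      = (\<Sum>k\<le>n. of_nat (n choose k) * (nth_deriv_on I k f x * nth_deriv_on I (n - k) g x))"
    using smooth_on_sequence[OF I, of "\<lambda>x. f x * g x" F] by (auto simp: F_def)
qed

lemma smooth_on_power:
  assumes "perfect_set I" "smooth_on I f"
  shows "smooth_on I (\<lambda>x. f x ^ n)"
  by (induction n) (auto intro: smooth_on_const smooth_on_mult assms)

text \<open>The functions u h^(-k) with smooth \<open>u\<close> are closed under differentiation,
  because (u h^(-k))' = (u' h - k u h') h^(-k-1).\<close>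

lemma smooth_on_inverse:
  assumes I: "perfect_set I" and h: "smooth_on I h" and nz: "\<And>x. x \<in> I \<Longrightarrow> h x \<noteq> 0"
  shows "smooth_on I (\<lambda>x. inverse (h x))"
proof (rule smooth_on_family(1)[OF I, where \<F> = "{(\<lambda>x. u x * inverse (h x) ^ k) | u k. smooth_on I u}"])
  show "(\<lambda>x. inverse (h x)) \<in> {(\<lambda>x. u x * inverse (h x) ^ k) | u k. smooth_on I u}"
    using smooth_on_const[OF I, of 1] by (auto intro!: exI[of _ "\<lambda>_. 1"] exI[of _ "1::nat"])
next
  fix f assume "f \<in> {(\<lambda>x. u x * inverse (h x) ^ k) | u k. smooth_on I u}"
  then obtain u k where u: "smooth_on I u" and f: "f = (\<lambda>x. u x * inverse (h x) ^ k)" by blast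
  define v where "v = (\<lambda>x. 1 * (nth_deriv_on I 1 u x * h x) + (- real k) * (u x * nth_deriv_on I 1 h x))"
  have "smooth_on I v"
    unfolding v_def by (intro smooth_on_lincomb smooth_on_mult I u h smooth_on_deriv)
  moreover have "(f has_field_derivative v x * inverse (h x) ^ Suc k) (at x within I)" if x: "x \<in> I" for x
  proof -
    have "((\<lambda>x. u x * inverse (h x) ^ k) has_field_derivative v x * inverse (h x) ^ Suc k) (at x within I)"
      apply (rule derivative_eq_intros smooth_on_field_derivative[OF I u x]
          smooth_on_field_derivative[OF I h x] nz[OF x] refl)+
      using nz[OF x] unfolding v_def by (cases k) (auto simp: field_simps)
    then show ?thesis by (simp add: f)
  qed
  ultimately show "\<exists>g\<in>{(\<lambda>x. u x * inverse (h x) ^ k) | u k. smooth_on I u}.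
      \<forall>x\<in>I. (f has_field_derivative g x) (at x within I)"
    by (intro bexI[of _ "\<lambda>x. v x * inverse (h x) ^ Suc k"]) blast+
qed

lemma smooth_on_affine:
  assumes "smooth_on UNIV f"
  shows "smooth_on UNIV (\<lambda>x. f (c * x + d))"
    and "nth_deriv_on UNIV n (\<lambda>x. f (c * x + d)) x = c ^ n * nth_deriv_on UNIV n f (c * x + d)"
proof -
  have "((\<lambda>x. c ^ n * nth_deriv_on UNIV n f (c * x + d)) has_field_derivative
         c ^ Suc n * nth_deriv_on UNIV (Suc n) f (c * x + d)) (at x)" for n x
    by (rule derivative_eq_intros DERIV_chain2[OF smooth_on_nth_deriv[OF perfect_set_UNIV assms UNIV_I]] refl)+ auto
  then show "smooth_on UNIV (\<lambda>x. f (c * x + d))"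
    and "nth_deriv_on UNIV n (\<lambda>x. f (c * x + d)) x = c ^ n * nth_deriv_on UNIV n f (c * x + d)"
    using smooth_on_sequence[OF perfect_set_UNIV, of "\<lambda>x. f (c * x + d)"
        "\<lambda>n x. c ^ n * nth_deriv_on UNIV n f (c * x + d)"] by auto
qed

lemma nth_deriv_on_zero: "perfect_set I \<Longrightarrow> x \<in> I \<Longrightarrow> nth_deriv_on I n (\<lambda>x. 0) x = 0"
  using smooth_on_sequence(2)[of I "\<lambda>x. 0" "\<lambda>_ _. 0"] by simp

text \<open>At a point of an open set inside both domains, the filters within \<open>I\<close> and
  within \<open>K\<close> are both the full \<open>at x\<close>. This is how derivatives within a
  half-line are compared with derivatives on the line.\<close>

lemma nth_deriv_on_local:
  assumes I: "perfect_set I" and f: "smooth_on I f" and g: "smooth_on K g" and K: "perfect_set K"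
    and U: "open U" "U \<subseteq> I" "U \<subseteq> K" and eq: "\<And>x. x \<in> U \<Longrightarrow> f x = g x" and x: "x \<in> U"
  shows "nth_deriv_on I n f x = nth_deriv_on K n g x"
proof -
  have "\<forall>x\<in>U. nth_deriv_on I n f x = nth_deriv_on K n g x"
  proof (induction n)
    case (Suc n)
    show ?case
    proof
      fix x assume x: "x \<in> U"
      then have "at x within I = at x" "at x within K = at x"
        by (meson U at_within_open at_within_open_subset)+
      then have "(nth_deriv_on I n f has_field_derivative nth_deriv_on I (Suc n) f x) (at x)"
        and D: "(nth_deriv_on K n g has_field_derivative nth_deriv_on K (Suc n) g x) (at x)"
        using smooth_on_nth_deriv[OF I f, of x n] smooth_on_nth_deriv[OF K g, of x n] x U
        by (auto simp del: nth_deriv_on.simps)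
      from this(1) have "(nth_deriv_on K n g has_field_derivative nth_deriv_on I (Suc n) f x) (at x)"
        by (rule has_field_derivative_transform_within_open[where S = U]) (use U x Suc in auto)
      with D show "nth_deriv_on I (Suc n) f x = nth_deriv_on K (Suc n) g x"
        using DERIV_unique by blast
    qed
  qed (use eq in simp)
  then show ?thesis using x by blast
qed

text \<open>The induction works relative to \<open>I\<close>, so it also reaches an endpoint of
  \<open>I\<close>, where \<open>U \<inter> I\<close> is only relatively open.\<close>

lemma nth_deriv_on_eq_0:
  assumes I: "perfect_set I" and U: "open U" "\<And>x. x \<in> U \<inter> I \<Longrightarrow> f x = 0" and x: "x \<in> U \<inter> I"
  shows "nth_deriv_on I n f x = 0"
proof -
  have "\<forall>x\<in>U \<inter> I. nth_deriv_on I n f x = 0"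
  proof (induction n)
    case (Suc n)
    show ?case
    proof
      fix x assume x: "x \<in> U \<inter> I"
      then obtain e where e: "e > 0" "ball x e \<subseteq> U"
        using U(1) open_contains_ball by blast
      have "(nth_deriv_on I n f has_field_derivative 0) (at x within I)"
        by (rule has_field_derivative_transform_within[OF DERIV_const e(1)])
          (use x e Suc in \<open>auto simp: dist_commute subset_eq\<close>)
      then show "nth_deriv_on I (Suc n) f x = 0"
        using nth_deriv_on_Suc_eq[OF I] x by blast
    qed
  qed (use U in simp)
  then show ?thesis using x by blast
qed

lemma
  assumes f: "smooth_on UNIV f" and I: "perfect_set I"
  shows smooth_on_restrict: "smooth_on I f"
    and nth_deriv_on_restrict: "x \<in> I \<Longrightarrow> nth_deriv_on I n f x = nth_deriv_on UNIV n f x"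
  using smooth_on_sequence[OF I, of f "\<lambda>n. nth_deriv_on UNIV n f"]
    has_field_derivative_at_within[OF smooth_on_nth_deriv[OF perfect_set_UNIV f UNIV_I]] by simp_all

subsection \<open>Schwartz spaces\<close>

lemma weight_ge_1: "(1::real) \<le> (1 + x\<^sup>2) ^ n"
  by simp

lemma weight_pos: "(0::real) < (1 + x\<^sup>2) ^ n"
  using weight_ge_1[of x n] by linarith

lemma weight_mono: "m \<le> n \<Longrightarrow> (1 + x\<^sup>2 :: real) ^ m \<le> (1 + x\<^sup>2) ^ n"
  by (rule power_increasing) auto

text \<open>Decouples the exponent of the weight from the order of the derivative, which the
  definition ties to one \<open>n\<close>. One direction passes to \<open>max n j\<close>, the other
  sums the bounds of the finitely many orders up to \<open>n\<close>.\<close>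

lemma schwartz_iff:
  "f \<in> schwartz I \<longleftrightarrow> smooth_on I f \<and> (\<forall>x. x \<notin> I \<longrightarrow> f x = 0) \<and>
     (\<forall>n j. \<exists>C. \<forall>x\<in>I. (1 + x\<^sup>2) ^ n * \<bar>nth_deriv_on I j f x\<bar> \<le> C)"
proof -
  have "(\<forall>n. bdd_above (schwartz_values I n f)) \<longleftrightarrow>
        (\<forall>n j. \<exists>C. \<forall>x\<in>I. (1 + x\<^sup>2) ^ n * \<bar>nth_deriv_on I j f x\<bar> \<le> C)"
  proof (intro iffI allI)
    fix n j assume "\<forall>n. bdd_above (schwartz_values I n f)"
    then obtain C where "\<forall>y\<in>schwartz_values I (max n j) f. y \<le> C"
      by (meson bdd_above_def)
    then have C: "(1 + x\<^sup>2) ^ max n j * \<bar>nth_deriv_on I j f x\<bar> \<le> C" if "x \<in> I" for x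
      using that by (fastforce simp: schwartz_values_def)
    have "(1 + x\<^sup>2) ^ n * \<bar>nth_deriv_on I j f x\<bar> \<le> C" if "x \<in> I" for x
      using C[OF that] weight_mono[of n "max n j" x]
        mult_right_mono[of "(1 + x\<^sup>2) ^ n" "(1 + x\<^sup>2) ^ max n j" "\<bar>nth_deriv_on I j f x\<bar>"]
      by linarith
    then show "\<exists>C. \<forall>x\<in>I. (1 + x\<^sup>2) ^ n * \<bar>nth_deriv_on I j f x\<bar> \<le> C" by blast
  next
    fix n assume "\<forall>n j. \<exists>C. \<forall>x\<in>I. (1 + x\<^sup>2) ^ n * \<bar>nth_deriv_on I j f x\<bar> \<le> C"
    then obtain C where C: "\<And>j x. x \<in> I \<Longrightarrow> (1 + x\<^sup>2) ^ n * \<bar>nth_deriv_on I j f x\<bar> \<le> C j"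
      by metis
    have "(1 + x\<^sup>2) ^ n * \<bar>nth_deriv_on I j f x\<bar> \<le> (\<Sum>j\<le>n. \<bar>C j\<bar>)" if "x \<in> I" "j \<le> n" for x j
    proof -
      have "\<bar>C j\<bar> \<le> (\<Sum>j\<le>n. \<bar>C j\<bar>)"
        using that by (intro member_le_sum) auto
      then show ?thesis using C[OF that(1), of j] by linarith
    qed
    then show "bdd_above (schwartz_values I n f)"
      unfolding bdd_above_def schwartz_values_def by blast
  qed
  then show ?thesis unfolding schwartz_def by auto
qed

lemma schwartz_smooth: "f \<in> schwartz I \<Longrightarrow> smooth_on I f"
  by (simp add: schwartz_def)

lemma schwartz_zero: "f \<in> schwartz I \<Longrightarrow> x \<notin> I \<Longrightarrow> f x = 0"
  by (simp add: schwartz_def)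

lemma schwartz_bound:
  assumes "f \<in> schwartz I"
  obtains C where "C \<ge> 0" "\<And>x. x \<in> I \<Longrightarrow> (1 + x\<^sup>2) ^ n * \<bar>nth_deriv_on I j f x\<bar> \<le> C"
proof -
  obtain C where "\<And>x. x \<in> I \<Longrightarrow> (1 + x\<^sup>2) ^ n * \<bar>nth_deriv_on I j f x\<bar> \<le> C"
    using assms unfolding schwartz_iff by metis
  then have "(1 + x\<^sup>2) ^ n * \<bar>nth_deriv_on I j f x\<bar> \<le> \<bar>C\<bar>" if "x \<in> I" for x
    using that abs_ge_self order_trans by blast
  then show ?thesis
    using that abs_ge_zero by blast
qed

lemma schwartz_family:
  assumes I: "perfect_set I"
    and D: "\<And>f. f \<in> \<F> \<Longrightarrow> \<exists>g\<in>\<F>. \<forall>x\<in>I. (f has_field_derivative g x) (at x within I)"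
    and B: "\<And>f n. f \<in> \<F> \<Longrightarrow> \<exists>C. \<forall>x\<in>I. (1 + x\<^sup>2) ^ n * \<bar>f x\<bar> \<le> C"
    and f: "f \<in> \<F>" and 0: "\<And>x. x \<notin> I \<Longrightarrow> f x = 0"
  shows "f \<in> schwartz I"
  unfolding schwartz_iff
proof (intro conjI allI impI)
  show "smooth_on I f" by (rule smooth_on_family(1)[OF I D f])
  fix n j
  obtain g where "g \<in> \<F>" "\<forall>x\<in>I. nth_deriv_on I j f x = g x"
    using smooth_on_family(2)[OF I D f] by meson
  then show "\<exists>C. \<forall>x\<in>I. (1 + x\<^sup>2) ^ n * \<bar>nth_deriv_on I j f x\<bar> \<le> C"
    using B[of g n] by auto
qed (simp add: 0)

lemma schwartz_deriv:
  assumes I: "perfect_set I" and f: "f \<in> schwartz I"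
    and g: "\<And>x. x \<in> I \<Longrightarrow> g x = nth_deriv_on I m f x" and 0: "\<And>x. x \<notin> I \<Longrightarrow> g x = 0"
  shows "g \<in> schwartz I"
proof -
  have "smooth_on I (nth_deriv_on I m f)"
    by (intro smooth_on_deriv schwartz_smooth f)
  note * = smooth_on_cong[OF I this g] nth_deriv_on_cong[OF I this g]
  show ?thesis
    unfolding schwartz_iff using * 0 f
    by (auto simp: nth_deriv_on_add schwartz_iff)
qed

lemma schwartz_lincomb:
  assumes I: "perfect_set I" and f: "f \<in> schwartz I" and g: "g \<in> schwartz I"
  shows "(\<lambda>x. c * f x + d * g x) \<in> schwartz I"
  unfolding schwartz_iff
proof (intro conjI allI impI)
  note fg = schwartz_smooth[OF f] schwartz_smooth[OF g]
  show "smooth_on I (\<lambda>x. c * f x + d * g x)"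
    by (intro smooth_on_lincomb I fg)
  fix n j
  obtain C D where C: "\<And>x. x \<in> I \<Longrightarrow> (1 + x\<^sup>2) ^ n * \<bar>nth_deriv_on I j f x\<bar> \<le> C"
    and D: "\<And>x. x \<in> I \<Longrightarrow> (1 + x\<^sup>2) ^ n * \<bar>nth_deriv_on I j g x\<bar> \<le> D"
    by (meson f g schwartz_bound)
  have "(1 + x\<^sup>2) ^ n * \<bar>nth_deriv_on I j (\<lambda>x. c * f x + d * g x) x\<bar> \<le> \<bar>c\<bar> * C + \<bar>d\<bar> * D"
    if x: "x \<in> I" for x
  proof -
    have "(1 + x\<^sup>2) ^ n * \<bar>c * nth_deriv_on I j f x + d * nth_deriv_on I j g x\<bar>
        \<le> (1 + x\<^sup>2) ^ n * (\<bar>c\<bar> * \<bar>nth_deriv_on I j f x\<bar> + \<bar>d\<bar> * \<bar>nth_deriv_on I j g x\<bar>)"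
      by (intro mult_left_mono) (auto simp flip: abs_mult intro: abs_triangle_ineq)
    also have "\<dots> = \<bar>c\<bar> * ((1 + x\<^sup>2) ^ n * \<bar>nth_deriv_on I j f x\<bar>) +
        \<bar>d\<bar> * ((1 + x\<^sup>2) ^ n * \<bar>nth_deriv_on I j g x\<bar>)"
      by (simp add: algebra_simps)
    also have "\<dots> \<le> \<bar>c\<bar> * C + \<bar>d\<bar> * D"
      by (intro add_mono mult_left_mono C D x) auto
    finally show ?thesis
      by (simp add: nth_deriv_on_lincomb[OF I fg x])
  qed
  then show "\<exists>C. \<forall>x\<in>I. (1 + x\<^sup>2) ^ n * \<bar>nth_deriv_on I j (\<lambda>x. c * f x + d * g x) x\<bar> \<le> C"
    by blast
qed (use schwartz_zero[OF f] schwartz_zero[OF g] in auto)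

lemma schwartz_diff:
  assumes "perfect_set I" "f \<in> schwartz I" "g \<in> schwartz I"
  shows "(\<lambda>x. f x - g x) \<in> schwartz I"
  using schwartz_lincomb[OF assms, of 1 "-1"] by simp

lemma nth_deriv_on_diff:
  assumes "perfect_set I" "smooth_on I f" "smooth_on I g" "x \<in> I"
  shows "nth_deriv_on I n (\<lambda>x. f x - g x) x = nth_deriv_on I n f x - nth_deriv_on I n g x"
  using nth_deriv_on_lincomb[OF assms, of n 1 "-1"] by simp

lemma schwartz_seminorm_ge:
  assumes "f \<in> schwartz I" "x \<in> I" "j \<le> n"
  shows "(1 + x\<^sup>2) ^ n * \<bar>nth_deriv_on I j f x\<bar> \<le> schwartz_seminorm I n f"
  unfolding schwartz_seminorm_def using assms
  by (intro cSup_upper) (auto simp: schwartz_values_def schwartz_def)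

text \<open>\<open>Sup {}\<close> carries no information on the reals, hence the assumption that
  \<open>I\<close> is nonempty.\<close>

lemma schwartz_seminorm_le:
  assumes "I \<noteq> {}"
    and "\<And>x j. x \<in> I \<Longrightarrow> j \<le> n \<Longrightarrow> (1 + x\<^sup>2) ^ n * \<bar>nth_deriv_on I j f x\<bar> \<le> C"
  shows "schwartz_seminorm I n f \<le> C"
  unfolding schwartz_seminorm_def
proof (rule cSup_least)
  obtain x where "x \<in> I" using assms(1) by blast
  then have "(1 + x\<^sup>2) ^ n * \<bar>nth_deriv_on I 0 f x\<bar> \<in> schwartz_values I n f"
    unfolding schwartz_values_def by blast
  then show "schwartz_values I n f \<noteq> {}" by blast
qed (use assms(2) in \<open>auto simp: schwartz_values_def\<close>)

lemma schwartz_seminorm_nonneg: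
  assumes "f \<in> schwartz I" "I \<noteq> {}"
  shows "0 \<le> schwartz_seminorm I n f"
proof -
  obtain x where "x \<in> I" using assms by auto
  then have "(1 + x\<^sup>2) ^ n * \<bar>nth_deriv_on I 0 f x\<bar> \<le> schwartz_seminorm I n f"
    by (intro schwartz_seminorm_ge assms) auto
  moreover have "0 \<le> (1 + x\<^sup>2) ^ n * \<bar>nth_deriv_on I 0 f x\<bar>" by simp
  ultimately show ?thesis by linarith
qed

lemma schwartz_seminorm_triangle:
  assumes I: "perfect_set I" "I \<noteq> {}"
    and "f \<in> schwartz I" "g \<in> schwartz I" "h \<in> schwartz I"
  shows "schwartz_seminorm I n (\<lambda>x. f x - h x)
       \<le> schwartz_seminorm I n (\<lambda>x. f x - g x) + schwartz_seminorm I n (\<lambda>x. g x - h x)"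
proof (rule schwartz_seminorm_le[OF I(2)])
  fix x j assume x: "x \<in> I" "j \<le> n"
  let ?D = "\<lambda>f. nth_deriv_on I j f x"
  note [simp] = nth_deriv_on_diff[OF I(1) _ _ x(1)] assms(3-5)[THEN schwartz_smooth]
  have "(1 + x\<^sup>2) ^ n * \<bar>?D f - ?D h\<bar> \<le> (1 + x\<^sup>2) ^ n * (\<bar>?D f - ?D g\<bar> + \<bar>?D g - ?D h\<bar>)"
    by (intro mult_left_mono) auto
  also have "\<dots> \<le> schwartz_seminorm I n (\<lambda>x. f x - g x) + schwartz_seminorm I n (\<lambda>x. g x - h x)"
    unfolding distrib_left
    using schwartz_seminorm_ge[OF schwartz_diff[OF I(1)] x, of f g] assms
      schwartz_seminorm_ge[OF schwartz_diff[OF I(1)] x, of g h]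
    by (intro add_mono) auto
  finally show "(1 + x\<^sup>2) ^ n * \<bar>?D (\<lambda>x. f x - h x)\<bar>
      \<le> schwartz_seminorm I n (\<lambda>x. f x - g x) + schwartz_seminorm I n (\<lambda>x. g x - h x)"
    by simp
qed

lemma schwartz_seminorm_diff_self:
  assumes "perfect_set I" "I \<noteq> {}"
  shows "schwartz_seminorm I n (\<lambda>x. f x - f x) \<le> 0"
proof (rule schwartz_seminorm_le[OF assms(2)])
  fix x j assume "x \<in> I"
  then show "(1 + x\<^sup>2) ^ n * \<bar>nth_deriv_on I j (\<lambda>x. f x - f x) x\<bar> \<le> 0"
    by (simp add: nth_deriv_on_zero[OF assms(1)])
qed

section \<open>The Frechet topology: limits and continuity\<close>

lemma openin_schwartz_ball:
  assumes "f \<in> schwartz I" "e > 0"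
  shows "openin (schwartz_topology I) {g \<in> schwartz I. schwartz_seminorm I n (\<lambda>x. g x - f x) < e}"
  unfolding schwartz_topology_def by (rule topology_generated_by_Basis) (use assms in blast)

lemma topspace_schwartz:
  assumes "perfect_set I" "I \<noteq> {}"
  shows "topspace (schwartz_topology I) = schwartz I"
proof -
  have "f \<in> {g \<in> schwartz I. schwartz_seminorm I 0 (\<lambda>x. g x - f x) < 1}" if "f \<in> schwartz I" for f
    using that schwartz_seminorm_diff_self[OF assms, of 0 f] by simp
  moreover have "topspace (schwartz_topology I) \<subseteq> schwartz I"
    unfolding schwartz_topology_def topology_generated_by_topspace by blast
  ultimately show ?thesis
    using openin_schwartz_ball[of _ I 1 0] openin_subset[of "schwartz_topology I"] by fastforce
qed

text \<open>Convergence in all seminorms implies convergence in the topology: by the triangle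
  inequality \<open>h\<close> is eventually in every generating ball that contains \<open>g\<close>,
  and this property passes to finite intersections and to unions.\<close>

lemma closedin_schwartz_limit:
  assumes I: "perfect_set I" "I \<noteq> {}" and W: "closedin (schwartz_topology I) W"
    and h: "\<And>k::nat. h k \<in> W" and g: "g \<in> schwartz I"
    and lim: "\<And>n. (\<lambda>k. schwartz_seminorm I n (\<lambda>x. h k x - g x)) \<longlonglongrightarrow> 0"
  shows "g \<in> W"
proof -
  have hS: "h k \<in> schwartz I" for k
    using h closedin_subset[OF W] topspace_schwartz[OF I] by blast
  have "\<forall>\<^sub>F k in sequentially. h k \<in> U" if "openin (schwartz_topology I) U" "g \<in> U" for U
    using openin_topology_generated_by[OF that(1)[unfolded schwartz_topology_def]] that(2)
  proof (induction rule: generate_topology_on.induct)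
    case (Basis s)
    then obtain f n e where f: "f \<in> schwartz I" "e > 0"
      and s: "s = {g \<in> schwartz I. schwartz_seminorm I n (\<lambda>x. g x - f x) < e}"
      by blast
    have "0 < e - schwartz_seminorm I n (\<lambda>x. g x - f x)"
      using Basis s by simp
    then have "\<forall>\<^sub>F k in sequentially. schwartz_seminorm I n (\<lambda>x. h k x - g x)
        < e - schwartz_seminorm I n (\<lambda>x. g x - f x)"
      by (rule order_tendstoD(2)[OF lim])
    then show ?case
      unfolding s
    proof eventually_elim
      case (elim k)
      then show ?case
        using hS[of k] schwartz_seminorm_triangle[OF I hS[of k] g f(1), of n] by simp
    qed
  next
    case (Int a b)
    then show ?case by (auto intro: eventually_conj)
  next
    case (UN K)
    then obtain k where "k \<in> K" "g \<in> k" by blast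
    from UN.IH[OF this] show ?case
      by eventually_elim (use \<open>k \<in> K\<close> in blast)
  qed simp
  then have "limitin (schwartz_topology I) h g sequentially"
    using g by (auto simp: limitin_def topspace_schwartz[OF I])
  then show ?thesis
    by (rule limitin_closedin[OF _ W]) (use h in auto)
qed

lemma continuous_map_schwartz:
  assumes I: "perfect_set I" "I \<noteq> {}" and J: "perfect_set J" "J \<noteq> {}"
    and T: "\<And>f. f \<in> schwartz J \<Longrightarrow> T f \<in> schwartz I"
    and diff: "\<And>f g. f \<in> schwartz J \<Longrightarrow> g \<in> schwartz J \<Longrightarrow> T (\<lambda>x. f x - g x) = (\<lambda>x. T f x - T g x)"
    and bound: "\<And>n. \<exists>m C. \<forall>f\<in>schwartz J. schwartz_seminorm I n (T f) \<le> C * schwartz_seminorm J m f"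
  shows "continuous_map (schwartz_topology J) (schwartz_topology I) T"
  unfolding schwartz_topology_def[of I] continuous_on_generated_topo_iff topspace_schwartz[OF J]
proof (intro conjI allI impI)
  have "\<Union> {{g \<in> schwartz I. schwartz_seminorm I n (\<lambda>x. g x - f x) < e} |f n e. f \<in> schwartz I \<and> 0 < e}
      = schwartz I"
    using topspace_schwartz[OF I] unfolding schwartz_topology_def topology_generated_by_topspace .
  then show "T ` schwartz J \<subseteq> \<Union> {{g \<in> schwartz I. schwartz_seminorm I n (\<lambda>x. g x - f x) < e} |f n e. f \<in> schwartz I \<and> 0 < e}"
    using T by auto
next
  fix U assume "U \<in> {{g \<in> schwartz I. schwartz_seminorm I n (\<lambda>x. g x - f x) < e} |f n e. f \<in> schwartz I \<and> 0 < e}"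
  then obtain g0 n e where g0: "g0 \<in> schwartz I"
    and U: "U = {g \<in> schwartz I. schwartz_seminorm I n (\<lambda>x. g x - g0 x) < e}" by blast
  obtain m C where C: "\<And>f. f \<in> schwartz J \<Longrightarrow> schwartz_seminorm I n (T f) \<le> C * schwartz_seminorm J m f"
    using bound[of n] by blast
  show "openin (schwartz_topology J) (T -` U \<inter> schwartz J)"
  proof (subst openin_subopen, intro ballI)
    fix f assume "f \<in> T -` U \<inter> schwartz J"
    then have f: "f \<in> schwartz J" and fe: "schwartz_seminorm I n (\<lambda>x. T f x - g0 x) < e"
      by (auto simp: U)
    \<comment> \<open>The slack that \<open>f\<close> leaves below \<open>e\<close>, divided by
      \<open>\<bar>C\<bar> + 1\<close> because \<open>C\<close> may be 0 or negative.\<close>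
    define d where "d = (e - schwartz_seminorm I n (\<lambda>x. T f x - g0 x)) / (\<bar>C\<bar> + 1)"
    have d: "d > 0" using fe by (simp add: d_def)
    let ?B = "{h \<in> schwartz J. schwartz_seminorm J m (\<lambda>x. h x - f x) < d}"
    have "h \<in> T -` U" if "h \<in> ?B" for h
    proof -
      have h: "h \<in> schwartz J" and hd: "schwartz_seminorm J m (\<lambda>x. h x - f x) < d"
        using that by auto
      note hf = schwartz_diff[OF J(1) h f]
      note q = schwartz_seminorm_nonneg[OF hf J(2), of m]
      have "schwartz_seminorm I n (\<lambda>x. T h x - T f x) \<le> C * schwartz_seminorm J m (\<lambda>x. h x - f x)"
        using C[OF hf] by (simp add: diff h f)
      also have "\<dots> \<le> (\<bar>C\<bar> + 1) * schwartz_seminorm J m (\<lambda>x. h x - f x)"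
        by (intro mult_right_mono q) auto
      also have "\<dots> < (\<bar>C\<bar> + 1) * d"
        by (intro mult_strict_left_mono hd) auto
      also have "\<dots> = e - schwartz_seminorm I n (\<lambda>x. T f x - g0 x)"
        by (simp add: d_def)
      finally have "schwartz_seminorm I n (\<lambda>x. T h x - g0 x) < e"
        using schwartz_seminorm_triangle[OF I T[OF h] T[OF f] g0, of n] by linarith
      then show ?thesis using T[OF h] by (simp add: U)
    qed
    moreover have "f \<in> ?B"
      using f d schwartz_seminorm_diff_self[OF J, of m f] by simp
    ultimately show "\<exists>V. openin (schwartz_topology J) V \<and> f \<in> V \<and> V \<subseteq> T -` U \<inter> schwartz J"
      using openin_schwartz_ball[OF f d, of m] by blast
  qed
qed

section \<open>A smooth step function\<close>

lemma poly_times_exp_minus_tendsto_0: "((\<lambda>y::real. poly p y * exp (- y)) \<longlongrightarrow> 0) at_top"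
proof -
  have "((\<lambda>y. \<Sum>i\<le>degree p. coeff p i * (y ^ i / exp y)) \<longlongrightarrow> (\<Sum>i\<le>degree p. coeff p i * 0)) at_top"
    by (intro tendsto_sum tendsto_mult tendsto_const tendsto_power_div_exp_0)
  then show ?thesis
    by (simp add: poly_altdef sum_distrib_right exp_minus divide_inverse mult.assoc)
qed

text \<open>For p = 1 this is the classical exp(-1/x). The polynomial in y = 1/x closes the family
  under differentiation, which replaces p(y) by y^2 (p(y) - p'(y)).\<close>

definition flat_fun :: "real poly \<Rightarrow> real \<Rightarrow> real" where
  "flat_fun p x = (if x > 0 then poly p (inverse x) * exp (- inverse x) else 0)"

lemma flat_fun_has_derivative:
  "(flat_fun p has_field_derivative flat_fun ([:0, 0, 1:] * (p - pderiv p)) x) (at x)"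
proof -
  consider "x > 0" | "x < 0" | "x = 0" by linarith
  then show ?thesis
  proof cases
    case 1
    have "((\<lambda>x. poly p (inverse x) * exp (- inverse x)) has_field_derivative
        flat_fun ([:0, 0, 1:] * (p - pderiv p)) x) (at x)"
      using 1 by (auto intro!: derivative_eq_intros DERIV_chain2[OF poly_DERIV]
          simp: flat_fun_def algebra_simps power2_eq_square)
    then show ?thesis
      by (rule has_field_derivative_transform_within_open[where S = "{0<..}"])
        (use 1 in \<open>auto simp: flat_fun_def\<close>)
  next
    case 2
    have "((\<lambda>x. 0) has_field_derivative flat_fun ([:0, 0, 1:] * (p - pderiv p)) x) (at x)"
      using 2 by (simp add: flat_fun_def)
    then show ?thesis
      by (rule has_field_derivative_transform_within_open[where S = "{..<0}"])
        (use 2 in \<open>auto simp: flat_fun_def\<close>)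
  next
    case 3
    \<comment> \<open>With y = 1/h the difference quotient at 0 from the right is y p(y) exp(-y),
      and \<open>pCons 0 p\<close> is the polynomial y p(y).\<close>
    have "((\<lambda>h. flat_fun p h / h) \<longlongrightarrow> 0) (at_right 0)"
    proof (rule Lim_transform_eventually)
      show "((\<lambda>h. poly (pCons 0 p) (inverse h) * exp (- inverse h)) \<longlongrightarrow> 0) (at_right (0::real))"
        by (rule filterlim_compose[OF poly_times_exp_minus_tendsto_0 filterlim_inverse_at_top_right])
      show "\<forall>\<^sub>F h in at_right 0. poly (pCons 0 p) (inverse h) * exp (- inverse h) = flat_fun p h / h"
        by (simp add: eventually_at_right_less eventually_at_filter flat_fun_def divide_inverse)
    qed
    moreover have "((\<lambda>h. flat_fun p h / h) \<longlongrightarrow> 0) (at_left 0)"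
      by (rule Lim_transform_eventually[OF tendsto_const])
        (simp add: eventually_at_filter flat_fun_def)
    ultimately have "((\<lambda>h. flat_fun p h / h) \<longlongrightarrow> 0) (at 0)"
      by (rule filterlim_split_at[rotated])
    then show ?thesis
      using 3 by (simp add: DERIV_def flat_fun_def)
  qed
qed

lemma smooth_on_flat_fun: "smooth_on UNIV (flat_fun p)"
  by (rule smooth_on_family(1)[where \<F> = "range flat_fun"]) (use flat_fun_has_derivative in auto)

text \<open>The denominator is positive everywhere since x > 0 or 1 - x > 0. Outside (0,1) one of
  the two flat functions vanishes, which fixes the value as 0 on the left and 1 on the
  right.\<close>

definition smooth_step :: "real \<Rightarrow> real" where
  "smooth_step x = flat_fun 1 x * inverse (flat_fun 1 x + flat_fun 1 (1 - x))"

lemma smooth_step_0: "x \<le> 0 \<Longrightarrow> smooth_step x = 0"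
  and smooth_step_1: "x \<ge> 1 \<Longrightarrow> smooth_step x = 1"
  by (auto simp: smooth_step_def flat_fun_def)

lemma smooth_on_smooth_step: "smooth_on UNIV smooth_step"
proof -
  have "smooth_on UNIV (\<lambda>x. flat_fun 1 ((-1) * x + 1))"
    by (rule smooth_on_affine[OF smooth_on_flat_fun])
  moreover have "flat_fun 1 x + flat_fun 1 (1 - x) > 0" for x
    by (cases "x > 0") (auto simp: flat_fun_def add_pos_nonneg)
  ultimately show ?thesis
    unfolding smooth_step_def
    by (intro smooth_on_mult smooth_on_inverse smooth_on_add smooth_on_flat_fun perfect_set_UNIV)
      (auto simp: less_imp_neq[symmetric])
qed

text \<open>On the compact interval [0,1] the derivative is bounded by continuity; elsewhere the
  function is locally constant.\<close>

lemma bounded_nth_deriv_smooth_step: "\<exists>K. \<forall>x. \<bar>nth_deriv_on UNIV n smooth_step x\<bar> \<le> K"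
proof -
  let ?D = "nth_deriv_on UNIV n smooth_step"
  have "compact (?D ` {0..1})"
    by (intro compact_continuous_image continuous_on_subset[OF continuous_on_nth_deriv])
      (auto intro: smooth_on_smooth_step)
  then obtain K where K: "\<And>x. x \<in> {0..1} \<Longrightarrow> \<bar>?D x\<bar> \<le> K"
    using compact_imp_bounded by (fastforce simp: bounded_iff)
  have const: "\<bar>nth_deriv_on UNIV n (\<lambda>x. c) x\<bar> \<le> \<bar>c\<bar>" for c x :: real
    using smooth_on_sequence(2)[OF perfect_set_UNIV, of "\<lambda>x. c" "\<lambda>n x. if n = 0 then c else 0" x n]
    by auto
  have "\<bar>?D x\<bar> \<le> max K 1" for x
  proof -
    consider "x \<in> {0..1}" | "x \<in> {..<0}" | "x \<in> {1<..}" by fastforce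
    then show ?thesis
    proof cases
      case 1
      then show ?thesis using K by fastforce
    next
      case 2
      have "?D x = 0"
        by (rule nth_deriv_on_eq_0[of _ "{..<0}"]) (use 2 in \<open>auto simp: smooth_step_0\<close>)
      then show ?thesis by simp
    next
      case 3
      have "?D x = nth_deriv_on UNIV n (\<lambda>x. 1) x"
        by (rule nth_deriv_on_local[OF _ smooth_on_smooth_step smooth_on_const _ _ _ _ _ 3])
          (auto simp: smooth_step_1)
      then show ?thesis using const[of 1 x] by simp
    qed
  qed
  then show ?thesis by blast
qed

subsection \<open>Growth of symbols\<close>

text \<open>\<open>bell \<phi> n i\<close> is the coefficient of \<open>f\<^sup>(\<^sup>i\<^sup>) \<circ> \<phi>\<close> in the Faa di Bruno formula
  for the \<open>n\<close>-th derivative of \<open>f \<circ> \<phi>\<close>.\<close>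

primrec bell :: "(real \<Rightarrow> real) \<Rightarrow> nat \<Rightarrow> nat \<Rightarrow> real \<Rightarrow> real" where
  "bell \<phi> 0 = (\<lambda>i x. if i = 0 then 1 else 0)"
| "bell \<phi> (Suc n) = (\<lambda>i x. nth_deriv_on UNIV 1 (bell \<phi> n i) x +
      (if i = 0 then 0 else bell \<phi> n (i - 1) x) * nth_deriv_on UNIV 1 \<phi> x)"

lemma smooth_on_bell: "smooth_on UNIV \<phi> \<Longrightarrow> smooth_on UNIV (bell \<phi> n i)"
proof (induction n arbitrary: i)
  case 0
  show ?case by (simp add: smooth_on_const)
next
  case (Suc n)
  have "smooth_on UNIV (\<lambda>x. if i = 0 then 0 else bell \<phi> n (i - 1) x)"
    by (cases i) (auto intro: Suc smooth_on_const)
  then show ?case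
    unfolding bell.simps
    by (intro smooth_on_add smooth_on_mult smooth_on_deriv Suc perfect_set_UNIV)
qed

lemma bell_eq_0: "n < i \<Longrightarrow> bell \<phi> n i = (\<lambda>x. 0)"
proof (induction n arbitrary: i)
  case (Suc n)
  then have *: "bell \<phi> n i = (\<lambda>x. 0)" "bell \<phi> n (i - 1) = (\<lambda>x. 0)" by simp_all
  show ?case
    unfolding bell.simps * using nth_deriv_on_zero[OF perfect_set_UNIV, of _ 1] by simp
qed simp

lemma
  assumes I: "perfect_set I" and J: "perfect_set J" and f: "smooth_on J f"
    and \<phi>: "smooth_on UNIV \<phi>" and sub: "\<phi> ` I \<subseteq> J"
  shows smooth_on_compose: "smooth_on I (\<lambda>x. f (\<phi> x))"
    and nth_deriv_on_compose: "x \<in> I \<Longrightarrow> nth_deriv_on I n (\<lambda>x. f (\<phi> x)) x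
      = (\<Sum>i\<le>n. nth_deriv_on J i f (\<phi> x) * bell \<phi> n i x)"
proof -
  define F where "F n x = (\<Sum>i\<le>n. nth_deriv_on J i f (\<phi> x) * bell \<phi> n i x)" for n x
  have "(F n has_field_derivative F (Suc n) x) (at x within I)" if x: "x \<in> I" for n x
  proof -
    let ?f = "\<lambda>i. nth_deriv_on J i f (\<phi> x)" and ?d = "nth_deriv_on UNIV 1 \<phi> x"
    have d\<phi>: "(\<phi> has_field_derivative ?d) (at x within I)"
      using smooth_on_field_derivative[OF perfect_set_UNIV \<phi>] has_field_derivative_at_within by blast
    have df: "((\<lambda>x. nth_deriv_on J i f (\<phi> x)) has_field_derivative ?f (Suc i) * ?d) (at x within I)" for i
      using DERIV_image_chain[OF has_field_derivative_subset[OF smooth_on_nth_deriv[OF J f] sub] d\<phi>]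
        x sub by (force simp: o_def)
    have db: "(bell \<phi> n i has_field_derivative nth_deriv_on UNIV 1 (bell \<phi> n i) x) (at x within I)" for i
      using smooth_on_field_derivative[OF perfect_set_UNIV smooth_on_bell[OF \<phi>]]
        has_field_derivative_at_within by blast
    have "(F n has_field_derivative (\<Sum>i\<le>n. ?f i * nth_deriv_on UNIV 1 (bell \<phi> n i) x +
        ?f (Suc i) * ?d * bell \<phi> n i x)) (at x within I)"
      unfolding F_def by (rule DERIV_sum) (rule DERIV_mult'[OF df db])
    also have "(\<Sum>i\<le>n. ?f i * nth_deriv_on UNIV 1 (bell \<phi> n i) x + ?f (Suc i) * ?d * bell \<phi> n i x)
      = (\<Sum>i\<le>n. ?f i * nth_deriv_on UNIV 1 (bell \<phi> n i) x) + (\<Sum>i\<le>n. ?f (Suc i) * (bell \<phi> n i x * ?d))"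
      by (simp add: sum.distrib mult_ac del: nth_deriv_on.simps)
    \<comment> \<open>Adding the term i = n + 1 costs nothing, since
      \<open>bell \<phi> n (Suc n)\<close> is zero. With the other sum shifted by one, the two
      combine to the recursion of \<open>bell\<close>.\<close>
    also have "(\<Sum>i\<le>n. ?f i * nth_deriv_on UNIV 1 (bell \<phi> n i) x)
      = (\<Sum>i\<le>Suc n. ?f i * nth_deriv_on UNIV 1 (bell \<phi> n i) x)"
      using nth_deriv_on_zero[OF perfect_set_UNIV, of x 1]
      by (simp add: bell_eq_0 del: nth_deriv_on.simps)
    also have "(\<Sum>i\<le>n. ?f (Suc i) * (bell \<phi> n i x * ?d)) =
        (\<Sum>i\<le>Suc n. ?f i * ((if i = 0 then 0 else bell \<phi> n (i - 1) x) * ?d))"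
      by (subst sum.atMost_Suc_shift) (simp del: nth_deriv_on.simps)
    also have "(\<Sum>i\<le>Suc n. ?f i * nth_deriv_on UNIV 1 (bell \<phi> n i) x) + \<dots> = F (Suc n) x"
      unfolding F_def bell.simps by (simp only: sum.distrib[symmetric] distrib_left[symmetric])
    finally show ?thesis .
  qed
  then show "smooth_on I (\<lambda>x. f (\<phi> x))" "x \<in> I \<Longrightarrow> nth_deriv_on I n (\<lambda>x. f (\<phi> x)) x
      = (\<Sum>i\<le>n. nth_deriv_on J i f (\<phi> x) * bell \<phi> n i x)"
    using smooth_on_sequence[OF I, of "\<lambda>x. f (\<phi> x)" F] by (auto simp: F_def)
qed

section \<open>Test functions made of separated bumps\<close>

text \<open>Bumps at the widely separated positions \<open>t m\<close>, the \<open>m\<close>-th with a weight of exponent \<open>m\<close>,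
  so that the weights beat every fixed power.\<close>

definition hump :: "(nat \<Rightarrow> real) \<Rightarrow> (real \<Rightarrow> real) \<Rightarrow> real \<Rightarrow> real" where
  "hump t u x = (\<Sum>m < nat \<lceil>\<bar>x\<bar>\<rceil> + 3. u (x - t m) / (1 + (t m)\<^sup>2) ^ m)"

context
  fixes t :: "nat \<Rightarrow> real"
  assumes sep: "\<And>m. \<bar>t (Suc m)\<bar> > \<bar>t m\<bar> + 5"
begin

lemma hump_positions_apart: "m < l \<Longrightarrow> \<bar>t l\<bar> > \<bar>t m\<bar> + 5"
proof (induction l)
  case (Suc l)
  then show ?case using sep[of l] by (cases "m = l") auto
qed simp

lemma hump_position_ge: "\<bar>t m\<bar> \<ge> real m"
proof (induction m)
  case (Suc m)
  then show ?case using sep[of m] by simp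
qed simp

text \<open>Since |t m| is at least m and \<open>u\<close> vanishes outside [-2,2], all terms with m
  > |x| + 2 are zero. So \<open>hump\<close> is in effect an infinite sum, and any larger cutoff
  gives the same value.\<close>

lemma hump_eq_sum:
  assumes u: "\<And>s. \<bar>s\<bar> > 2 \<Longrightarrow> u s = 0" and N: "real N \<ge> \<bar>x\<bar> + 3"
  shows "hump t u x = (\<Sum>m<N. u (x - t m) / (1 + (t m)\<^sup>2) ^ m)"
proof -
  let ?N = "nat \<lceil>\<bar>x\<bar>\<rceil> + 3"
  have "u (x - t m) = 0" if "m \<notin> {..<?N}" for m
    by (rule u) (use that hump_position_ge[of m] in \<open>simp; linarith\<close>)
  moreover have "?N \<le> N" using N by linarith
  ultimately show ?thesis
    unfolding hump_def by (intro sum.mono_neutral_left) auto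
qed

text \<open>The positions differ by more than 5 in modulus while each bump has radius 2, so near
  \<open>t m\<close> every other bump vanishes.\<close>

lemma hump_eq_single:
  assumes u: "\<And>s. \<bar>s\<bar> > 2 \<Longrightarrow> u s = 0" and x: "\<bar>x - t m\<bar> \<le> 2"
  shows "hump t u x = u (x - t m) / (1 + (t m)\<^sup>2) ^ m"
proof -
  have "u (x - t l) = 0" if "l \<noteq> m" for l
  proof (rule u)
    have "\<bar>t l\<bar> > \<bar>t m\<bar> + 5 \<or> \<bar>t m\<bar> > \<bar>t l\<bar> + 5"
      using hump_positions_apart that by (meson nat_neq_iff)
    then show "\<bar>x - t l\<bar> > 2" using x by linarith
  qed
  moreover have "m < nat \<lceil>\<bar>x\<bar>\<rceil> + 3"
    using hump_position_ge[of m] x by linarith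
  ultimately have "hump t u x = (\<Sum>k\<in>{m}. u (x - t k) / (1 + (t k)\<^sup>2) ^ k)"
    unfolding hump_def by (intro sum.mono_neutral_right) auto
  then show ?thesis by simp
qed

lemma hump_has_derivative:
  assumes u: "smooth_on UNIV u" "\<And>s. \<bar>s\<bar> > 2 \<Longrightarrow> u s = 0"
  shows "(hump t u has_field_derivative hump t (nth_deriv_on UNIV 1 u) x) (at x)"
proof -
  \<comment> \<open>One more than the cutoff at \<open>x\<close>, so that a single finite sum
    represents \<open>hump\<close> on the whole unit ball around \<open>x\<close>.\<close>
  define N where "N = nat \<lceil>\<bar>x\<bar>\<rceil> + 4"
  have N: "real N \<ge> \<bar>y\<bar> + 3" if "y \<in> ball x 1" for y
    using that unfolding N_def dist_real_def mem_ball by linarith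
  have 0: "nth_deriv_on UNIV 1 u s = 0" if "\<bar>s\<bar> > 2" for s
    using that by (intro nth_deriv_on_eq_0[OF perfect_set_UNIV, of "{s. \<bar>s\<bar> > 2}"])
      (auto intro!: u(2) open_Collect_less continuous_intros)
  have "((\<lambda>y. u (y - t m) / (1 + (t m)\<^sup>2) ^ m) has_field_derivative
      nth_deriv_on UNIV 1 u (x - t m) / (1 + (t m)\<^sup>2) ^ m) (at x)" for m
  proof (rule DERIV_cdivide)
    have "((\<lambda>y. y - t m) has_field_derivative 1) (at x)"
      by (auto intro!: derivative_eq_intros)
    from DERIV_chain2[OF smooth_on_field_derivative[OF perfect_set_UNIV u(1) UNIV_I] this]
    show "((\<lambda>y. u (y - t m)) has_field_derivative nth_deriv_on UNIV 1 u (x - t m)) (at x)"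
      by simp
  qed
  then have "((\<lambda>y. \<Sum>m<N. u (y - t m) / (1 + (t m)\<^sup>2) ^ m) has_field_derivative
      (\<Sum>m<N. nth_deriv_on UNIV 1 u (x - t m) / (1 + (t m)\<^sup>2) ^ m)) (at x)"
    by (intro DERIV_sum)
  moreover have "hump t (nth_deriv_on UNIV 1 u) x = (\<Sum>m<N. nth_deriv_on UNIV 1 u (x - t m) / (1 + (t m)\<^sup>2) ^ m)"
    by (intro hump_eq_sum 0 N) simp_all
  ultimately have "((\<lambda>y. \<Sum>m<N. u (y - t m) / (1 + (t m)\<^sup>2) ^ m) has_field_derivative
      hump t (nth_deriv_on UNIV 1 u) x) (at x)"
    by simp
  then show ?thesis
    by (rule has_field_derivative_transform_within_open[where S = "ball x 1"])
      (auto intro!: hump_eq_sum[symmetric] u(2) N)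
qed

lemma
  assumes u: "smooth_on UNIV u" "\<And>s. \<bar>s\<bar> > 2 \<Longrightarrow> u s = 0"
  shows nth_deriv_on_hump: "nth_deriv_on UNIV n (hump t u) x = hump t (nth_deriv_on UNIV n u) x"
    and hump_schwartz: "hump t u \<in> schwartz UNIV"
proof -
  have 0: "nth_deriv_on UNIV n u s = 0" if "\<bar>s\<bar> > 2" for s n
    using that by (intro nth_deriv_on_eq_0[OF perfect_set_UNIV, of "{s. \<bar>s\<bar> > 2}"])
      (auto intro!: u(2) open_Collect_less continuous_intros)
  have D: "(hump t (nth_deriv_on UNIV n u) has_field_derivative
      hump t (nth_deriv_on UNIV (Suc n) u) x) (at x)" for n x
    using hump_has_derivative[OF smooth_on_deriv[OF u(1)] 0, of n x]
    by (simp only: nth_deriv_on_add) simp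
  note * = smooth_on_sequence[OF perfect_set_UNIV, of "hump t u" "\<lambda>n. hump t (nth_deriv_on UNIV n u)"]
  show n: "nth_deriv_on UNIV n (hump t u) x = hump t (nth_deriv_on UNIV n u) x" for n x
    using *(2) D by simp
  have "\<exists>C. \<forall>x. (1 + x\<^sup>2) ^ n * \<bar>hump t (nth_deriv_on UNIV j u) x\<bar> \<le> C" for n j
  proof -
    let ?v = "nth_deriv_on UNIV j u"
    have "compact (?v ` {-2..2})"
      by (intro compact_continuous_image continuous_on_subset[OF continuous_on_nth_deriv]) (auto intro: u)
    then obtain K where K: "\<And>s. s \<in> {-2..2} \<Longrightarrow> \<bar>?v s\<bar> \<le> K"
      using compact_imp_bounded by (fastforce simp: bounded_iff)
    have K0: "K \<ge> 0" using K[of 0] by simp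
    \<comment> \<open>Bounds the quotient of the weights: the 1 serves the bumps with m \<ge> n,
      where the exponent m wins, and the sum serves the finitely many with m < n.\<close>
    define S where "S = 1 + (\<Sum>m<n. (1 + (t m)\<^sup>2) ^ n)"
    have S: "S \<ge> 1" by (simp add: S_def sum_nonneg)
    have "(1 + x\<^sup>2) ^ n * \<bar>hump t ?v x\<bar> \<le> 9 ^ n * K * S" for x
    proof (cases "\<exists>m. \<bar>x - t m\<bar> \<le> 2")
      case True
      then obtain m where m: "\<bar>x - t m\<bar> \<le> 2" by blast
      have "(x - t m)\<^sup>2 \<le> 4"
        using abs_le_square_iff[of "x - t m" 2] m by simp
      moreover have "x\<^sup>2 \<le> 2 * (x - t m)\<^sup>2 + 2 * (t m)\<^sup>2"
        using zero_le_power2[of "x - 2 * t m"] by (simp add: power2_eq_square algebra_simps)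
      moreover have "1 + b \<le> 9 * (1 + c)" if "a \<le> 4" "b \<le> 2 * a + 2 * c" "0 \<le> c" for a b c :: real
        using that by (simp add: distrib_left)
      \<comment> \<open>The factor 9 comes from 1 + x^2 \<le> 1 + 2 * 4 + 2 (t m)^2.\<close>
      ultimately have "1 + x\<^sup>2 \<le> 9 * (1 + (t m)\<^sup>2)"
        using zero_le_power2 by blast
      then have "(1 + x\<^sup>2) ^ n \<le> 9 ^ n * (1 + (t m)\<^sup>2) ^ n"
        by (metis add_nonneg_nonneg power_mono power_mult_distrib zero_le_one zero_le_power2)
      moreover have ratio: "(1 + (t m)\<^sup>2) ^ n / (1 + (t m)\<^sup>2) ^ m \<le> S"
      proof (cases "m < n")
        case True
        have "(1 + (t m)\<^sup>2) ^ n / (1 + (t m)\<^sup>2) ^ m \<le> (1 + (t m)\<^sup>2) ^ n / 1"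
          by (intro divide_left_mono weight_ge_1) (auto intro: weight_pos)
        also have "\<dots> \<le> (\<Sum>m<n. (1 + (t m)\<^sup>2) ^ n)"
          using True by (auto intro!: member_le_sum[of m "{..<n}" "\<lambda>m. (1 + (t m)\<^sup>2) ^ n"])
        finally show ?thesis by (simp add: S_def)
      next
        case False
        have "(1 + (t m)\<^sup>2) ^ n / (1 + (t m)\<^sup>2) ^ m \<le> (1 + (t m)\<^sup>2) ^ m / (1 + (t m)\<^sup>2) ^ m"
          by (intro divide_right_mono weight_mono) (use False in auto)
        also have "\<dots> \<le> 1" by simp
        finally have "(1 + (t m)\<^sup>2) ^ n / (1 + (t m)\<^sup>2) ^ m \<le> 1" .
        then show ?thesis using S by linarith
      qed
      moreover have "\<bar>hump t ?v x\<bar> = \<bar>?v (x - t m)\<bar> / (1 + (t m)\<^sup>2) ^ m"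
        using hump_eq_single[OF 0 m] by (simp add: abs_mult power_abs)
      moreover have "\<bar>?v (x - t m)\<bar> \<le> K"
        by (rule K) (use m in auto)
      ultimately have "(1 + x\<^sup>2) ^ n * \<bar>hump t ?v x\<bar> \<le> 9 ^ n * (1 + (t m)\<^sup>2) ^ n * (K / (1 + (t m)\<^sup>2) ^ m)"
        by (intro mult_mono) (auto intro!: divide_right_mono)
      also have "\<dots> = 9 ^ n * K * ((1 + (t m)\<^sup>2) ^ n / (1 + (t m)\<^sup>2) ^ m)" by simp
      also have "\<dots> \<le> 9 ^ n * K * S"
        using ratio K0 by (intro mult_left_mono) auto
      finally show ?thesis .
    next
      case False
      then have "hump t ?v x = 0"
        unfolding hump_def by (intro sum.neutral) (auto simp: not_le intro!: 0)
      then show ?thesis using K0 S by simp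
    qed
    then show ?thesis by blast
  qed
  then show "hump t u \<in> schwartz UNIV"
    unfolding schwartz_iff using n *(1) D by simp
qed

end

lemma nth_deriv_monomial_at_0:
  "nth_deriv_on UNIV l (\<lambda>s. s ^ i / fact i) 0 = (if l = i then 1 else 0)"
proof -
  define F :: "nat \<Rightarrow> real \<Rightarrow> real" where "F l s = (if l \<le> i then s ^ (i - l) / fact (i - l) else 0)" for l s
  have "(F l has_field_derivative F (Suc l) s) (at s)" for l s
  proof (cases "l < i")
    case True
    then obtain k where k: "i - l = Suc k" "i - Suc l = k"
      by (metis Suc_diff_Suc)
    then have "F l = (\<lambda>s. s ^ Suc k / fact (Suc k))" "F (Suc l) s = s ^ k / fact k"
      using True unfolding F_def by (auto simp: fun_eq_iff)
    moreover have "((\<lambda>s. s ^ Suc k / fact (Suc k)) has_field_derivative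
        real (Suc k) * s ^ k / (real (Suc k) * fact k)) (at s)"
      by (rule DERIV_cdivide[THEN DERIV_cong]) (auto intro!: derivative_eq_intros simp del: power_Suc)
    ultimately show ?thesis
      by (metis nonzero_mult_divide_mult_cancel_left of_nat_eq_0_iff nat.distinct(2))
  next
    case False
    then have "F l = (\<lambda>s. F l 0)" "F (Suc l) s = 0"
      by (auto simp: F_def fun_eq_iff)
    then show ?thesis using DERIV_const by metis
  qed
  then have "nth_deriv_on UNIV l (\<lambda>s. s ^ i / fact i) 0 = F l 0"
    using smooth_on_sequence(2)[OF perfect_set_UNIV, of "\<lambda>s. s ^ i / fact i" F] by (auto simp: F_def)
  then show ?thesis by (auto simp: F_def)
qed

text \<open>Multiplying s^i / i! by a plateau that is 1 for |s| \<le> 1 leaves the derivatives at 0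
  unchanged. Such a jet isolates a single coefficient in the Faa di Bruno formula.\<close>

lemma jet_bump:
  obtains u where "smooth_on UNIV u" "\<And>s. \<bar>s\<bar> > 2 \<Longrightarrow> u s = 0"
    "\<And>l. nth_deriv_on UNIV l u 0 = (if l = i then 1 else 0)"
proof
  let ?p = "\<lambda>s :: real. s ^ i / fact i"
  define u where "u s = ?p s * (smooth_step (1 * s + 2) * smooth_step ((-1) * s + 2))" for s
  have p: "smooth_on UNIV ?p"
    using smooth_on_mult[OF _ smooth_on_power[OF _ smooth_on_ident, of UNIV i] smooth_on_const, of "1 / fact i"]
    by simp
  show u: "smooth_on UNIV u"
    unfolding u_def
    by (intro smooth_on_mult p smooth_on_affine(1) smooth_on_smooth_step perfect_set_UNIV)
  show "u s = 0" if "\<bar>s\<bar> > 2" for s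
    using that smooth_step_0[of "s + 2"] smooth_step_0[of "2 - s"]
    by (cases "s < 0") (auto simp: u_def)
  show "nth_deriv_on UNIV l u 0 = (if l = i then 1 else 0)" for l
    unfolding nth_deriv_monomial_at_0[symmetric]
    by (rule nth_deriv_on_local[OF _ u p _ open_ball[of 0 1]])
      (auto simp: u_def smooth_step_1 dist_real_def)
qed

section \<open>Coefficient bounds and continuity of composition\<close>

text \<open>A gliding hump argument. If every bound fails, there are points \<open>X m\<close> with
  widely spaced images at which the bound with constant m and exponent m fails. The hump with i-th
  derivative (1 + \<phi>(X m)^2)^(-m) at \<phi>(X m), and all other derivatives 0 there, is
  Schwartz, but its composition with \<phi> violates a Schwartz bound.\<close>

lemma symbol_bell_bound:
  assumes \<phi>: "schwartz_symbol \<phi>" and proper: "\<And>L. \<exists>K. \<forall>x\<in>I. \<bar>\<phi> x\<bar> \<le> L \<longrightarrow> \<bar>x\<bar> \<le> K"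
    and ij: "i \<le> j"
  shows "\<exists>C m. \<forall>x\<in>I. (1 + x\<^sup>2) ^ n * \<bar>bell \<phi> j i x\<bar> \<le> C * (1 + (\<phi> x)\<^sup>2) ^ m"
proof (rule ccontr)
  assume neg: "\<not> ?thesis"
  have smooth: "smooth_on UNIV \<phi>" using \<phi> by (simp add: schwartz_symbol_def)
  let ?w = "\<lambda>x. (1 + x\<^sup>2) ^ n * \<bar>bell \<phi> j i x\<bar>"
  \<comment> \<open>Points of \<open>I\<close> with |\<phi> x| \<le> L lie in a compact interval,
    where the left-hand side is at most B. A violation of the bound with constant and exponent m'
    \<ge> B must therefore occur where |\<phi> x| > L.\<close>
  have far: "\<exists>x\<in>I. \<bar>\<phi> x\<bar> > L \<and> ?w x > real m * (1 + (\<phi> x)\<^sup>2) ^ m" for L m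
  proof -
    obtain K where K: "\<And>x. x \<in> I \<Longrightarrow> \<bar>\<phi> x\<bar> \<le> L \<Longrightarrow> \<bar>x\<bar> \<le> K" using proper by blast
    have "compact (?w ` {-K..K})"
      by (intro compact_continuous_image continuous_intros
          continuous_on_subset[OF smooth_on_continuous[OF smooth_on_bell[OF smooth]]]) auto
    then obtain B where B: "\<And>x. x \<in> {-K..K} \<Longrightarrow> ?w x \<le> B"
      using compact_imp_bounded by (fastforce simp: bounded_iff)
    obtain m' where m': "real m' \<ge> B" "m' \<ge> m"
      by (metis linear nat_le_real_less of_nat_le_iff order_trans real_arch_simple)
    obtain x where x: "x \<in> I" "?w x > real m' * (1 + (\<phi> x)\<^sup>2) ^ m'"
      using neg by (meson not_le)
    have "real m' * 1 \<le> real m' * (1 + (\<phi> x)\<^sup>2) ^ m'"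
      by (intro mult_left_mono weight_ge_1) auto
    then have "?w x > B" using x m' by linarith
    then have "\<bar>\<phi> x\<bar> > L"
      using B[of x] K[OF x(1)] by (fastforce simp: abs_le_iff not_le[symmetric])
    moreover have "real m * (1 + (\<phi> x)\<^sup>2) ^ m \<le> real m' * (1 + (\<phi> x)\<^sup>2) ^ m'"
      using m' by (intro mult_mono weight_mono) auto
    ultimately show ?thesis using x by force
  qed
  \<comment> \<open>Dependent choice: \<open>far\<close> with L = |\<phi>(X m)| + 5 yields the next
    point at the spacing that the humps require.\<close>
  have "\<exists>X. \<forall>m. (X m \<in> I \<and> ?w (X m) > real m * (1 + (\<phi> (X m))\<^sup>2) ^ m) \<and> \<bar>\<phi> (X (Suc m))\<bar> > \<bar>\<phi> (X m)\<bar> + 5"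
    by (rule dependent_nat_choice) (use far in blast)+
  then obtain X where X: "\<And>m. ?w (X m) > real m * (1 + (\<phi> (X m))\<^sup>2) ^ m"
    and sep: "\<And>m. \<bar>\<phi> (X (Suc m))\<bar> > \<bar>\<phi> (X m)\<bar> + 5" by blast
  obtain u where u: "smooth_on UNIV u" "\<And>s. \<bar>s\<bar> > 2 \<Longrightarrow> u s = 0"
    and jet: "\<And>l. nth_deriv_on UNIV l u 0 = (if l = i then 1 else 0)"
    using jet_bump by metis
  let ?t = "\<lambda>m. \<phi> (X m)"
  define f where "f = hump ?t u"
  have f: "f \<in> schwartz UNIV"
    unfolding f_def by (rule hump_schwartz[where t = ?t, OF sep u])
  then have "(\<lambda>x. f (\<phi> x)) \<in> schwartz UNIV"
    using \<phi> by (auto simp: schwartz_symbol_def o_def)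
  then obtain C where C: "\<And>x. (1 + x\<^sup>2) ^ n * \<bar>nth_deriv_on UNIV j (\<lambda>x. f (\<phi> x)) x\<bar> \<le> C"
    by (meson schwartz_bound UNIV_I)
  \<comment> \<open>At \<open>X m\<close> the jet kills every term of the Faa di Bruno sum except l
    = i, so the weighted j-th derivative is the left-hand side of the violated bound divided by (1 +
    \<phi>(X m)^2)^m, which exceeds m.\<close>
  have "real m < C" for m
  proof -
    have 0: "nth_deriv_on UNIV l u s = 0" if "\<bar>s\<bar> > 2" for s l
      using that by (intro nth_deriv_on_eq_0[OF perfect_set_UNIV, of "{s. \<bar>s\<bar> > 2}"])
        (auto intro!: u(2) open_Collect_less continuous_intros)
    have "nth_deriv_on UNIV l f (?t m) = (if l = i then 1 else 0) / (1 + (?t m)\<^sup>2) ^ m" for l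
      using nth_deriv_on_hump[where t = ?t and n = l and x = "?t m", OF sep u]
        hump_eq_single[where t = ?t and u = "nth_deriv_on UNIV l u" and x = "?t m" and m = m, OF sep 0]
      by (simp add: jet f_def)
    then have "nth_deriv_on UNIV j (\<lambda>x. f (\<phi> x)) (X m)
        = (\<Sum>l\<le>j. if l = i then bell \<phi> j l (X m) / (1 + (?t m)\<^sup>2) ^ m else 0)"
      unfolding nth_deriv_on_compose[OF perfect_set_UNIV perfect_set_UNIV schwartz_smooth[OF f] smooth subset_UNIV UNIV_I]
      by (intro sum.cong) simp_all
    also have "\<dots> = bell \<phi> j i (X m) / (1 + (?t m)\<^sup>2) ^ m"
      using ij by (simp only: sum.delta finite_atMost atMost_iff if_True)
    finally have "nth_deriv_on UNIV j (\<lambda>x. f (\<phi> x)) (X m) = bell \<phi> j i (X m) / (1 + (?t m)\<^sup>2) ^ m" .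
    then have "?w (X m) / (1 + (?t m)\<^sup>2) ^ m \<le> C"
      using C[of "X m"] by (simp add: abs_mult power_abs)
    moreover have "(1 + (?t m)\<^sup>2) ^ m > 0"
      using weight_ge_1[of "?t m" m] by linarith
    ultimately show ?thesis
      using X[of m] by (smt (verit, best) mult_imp_div_pos_less pos_less_divide_eq)
  qed
  then show False
    using reals_Archimedean2[of C] by (meson less_asym)
qed

text \<open>Each Faa di Bruno coefficient costs a power of 1 + \<phi>(x)^2, and a seminorm of
  \<open>f\<close> on \<open>J\<close> of high enough order absorbs it at the point
  \<phi>(x).\<close>

lemma symbol_composition_bound:
  assumes \<phi>: "schwartz_symbol \<phi>" and proper: "\<And>L. \<exists>K. \<forall>x\<in>I. \<bar>\<phi> x\<bar> \<le> L \<longrightarrow> \<bar>x\<bar> \<le> K"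
    and I: "perfect_set I" and J: "perfect_set J" and sub: "\<phi> ` I \<subseteq> J"
  shows "\<exists>m C. \<forall>f\<in>schwartz J. \<forall>x\<in>I. \<forall>j\<le>n.
    (1 + x\<^sup>2) ^ n * \<bar>nth_deriv_on I j (composition_operator \<phi> I f) x\<bar> \<le> C * schwartz_seminorm J m f"
proof -
  have smooth: "smooth_on UNIV \<phi>" using \<phi> by (simp add: schwartz_symbol_def)
  have "\<forall>j i. \<exists>C m. i \<le> j \<longrightarrow> (\<forall>x\<in>I. (1 + x\<^sup>2) ^ n * \<bar>bell \<phi> j i x\<bar> \<le> C * (1 + (\<phi> x)\<^sup>2) ^ m)"
    using symbol_bell_bound[OF \<phi> proper] by metis
  then obtain C m where Cm: "\<And>j i x. i \<le> j \<Longrightarrow> x \<in> I \<Longrightarrow>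
      (1 + x\<^sup>2) ^ n * \<bar>bell \<phi> j i x\<bar> \<le> C j i * (1 + (\<phi> x)\<^sup>2) ^ m j i" by metis
  define C' where "C' = (\<Sum>j\<le>n. \<Sum>i\<le>j. \<bar>C j i\<bar>)"
  \<comment> \<open>The sum dominates all exponents that occur; the summand n ensures that
    derivatives of order i \<le> n are covered by the seminorm of index M.\<close>
  define M where "M = n + (\<Sum>j\<le>n. \<Sum>i\<le>j. m j i)"
  have C': "(\<Sum>i\<le>j. \<bar>C j i\<bar>) \<le> C'" if "j \<le> n" for j
    unfolding C'_def using that by (intro member_le_sum) (auto simp: sum_nonneg)
  have M: "m j i \<le> M" if "i \<le> j" "j \<le> n" for i j
  proof -
    have "m j i \<le> (\<Sum>i\<le>j. m j i)" using that by (intro member_le_sum) auto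
    also have "\<dots> \<le> (\<Sum>j\<le>n. \<Sum>i\<le>j. m j i)"
      using that by (intro member_le_sum[of j "{..n}" "\<lambda>j. \<Sum>i\<le>j. m j i"]) auto
    finally show ?thesis by (simp add: M_def)
  qed
  have "(1 + x\<^sup>2) ^ n * \<bar>nth_deriv_on I j (composition_operator \<phi> I f) x\<bar> \<le> C' * schwartz_seminorm J M f"
    if f: "f \<in> schwartz J" and x: "x \<in> I" and j: "j \<le> n" for f x j
  proof -
    note fs = schwartz_smooth[OF f]
    have q: "0 \<le> schwartz_seminorm J M f"
      by (rule schwartz_seminorm_nonneg[OF f]) (use x sub in auto)
    have "nth_deriv_on I j (composition_operator \<phi> I f) x = nth_deriv_on I j (\<lambda>x. f (\<phi> x)) x"
      by (rule nth_deriv_on_cong[OF I smooth_on_compose[OF I J fs smooth sub] _ x])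
        (simp add: composition_operator_def)
    also have "\<dots> = (\<Sum>i\<le>j. nth_deriv_on J i f (\<phi> x) * bell \<phi> j i x)"
      by (rule nth_deriv_on_compose[OF I J fs smooth sub x])
    finally have "(1 + x\<^sup>2) ^ n * \<bar>nth_deriv_on I j (composition_operator \<phi> I f) x\<bar>
      \<le> (1 + x\<^sup>2) ^ n * (\<Sum>i\<le>j. \<bar>nth_deriv_on J i f (\<phi> x) * bell \<phi> j i x\<bar>)"
      by (auto intro!: mult_left_mono)
    also have "\<dots> = (\<Sum>i\<le>j. \<bar>nth_deriv_on J i f (\<phi> x)\<bar> * ((1 + x\<^sup>2) ^ n * \<bar>bell \<phi> j i x\<bar>))"
      by (simp add: sum_distrib_left abs_mult mult_ac)
    also have "\<dots> \<le> (\<Sum>i\<le>j. \<bar>C j i\<bar> * schwartz_seminorm J M f)"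
    proof (rule sum_mono)
      fix i assume "i \<in> {..j}"
      then have i: "i \<le> j" by simp
      have "(1 + x\<^sup>2) ^ n * \<bar>bell \<phi> j i x\<bar> \<le> C j i * (1 + (\<phi> x)\<^sup>2) ^ m j i" by (rule Cm[OF i x])
      also have "\<dots> \<le> \<bar>C j i\<bar> * (1 + (\<phi> x)\<^sup>2) ^ M"
        using M[OF i j] by (intro mult_mono weight_mono) auto
      finally have "\<bar>nth_deriv_on J i f (\<phi> x)\<bar> * ((1 + x\<^sup>2) ^ n * \<bar>bell \<phi> j i x\<bar>)
        \<le> \<bar>nth_deriv_on J i f (\<phi> x)\<bar> * (\<bar>C j i\<bar> * (1 + (\<phi> x)\<^sup>2) ^ M)"
        by (rule mult_left_mono) simp
      also have "\<dots> = \<bar>C j i\<bar> * ((1 + (\<phi> x)\<^sup>2) ^ M * \<bar>nth_deriv_on J i f (\<phi> x)\<bar>)" by simp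
      also have "\<dots> \<le> \<bar>C j i\<bar> * schwartz_seminorm J M f"
        using x sub i j by (intro mult_left_mono schwartz_seminorm_ge f) (auto simp: M_def)
      finally show "\<bar>nth_deriv_on J i f (\<phi> x)\<bar> * ((1 + x\<^sup>2) ^ n * \<bar>bell \<phi> j i x\<bar>)
          \<le> \<bar>C j i\<bar> * schwartz_seminorm J M f" .
    qed
    also have "\<dots> \<le> C' * schwartz_seminorm J M f"
      unfolding sum_distrib_right[symmetric] by (intro mult_right_mono C' j q)
    finally show ?thesis .
  qed
  then show ?thesis by blast
qed

lemma
  assumes \<phi>: "schwartz_symbol \<phi>" and proper: "\<And>L. \<exists>K. \<forall>x\<in>I. \<bar>\<phi> x\<bar> \<le> L \<longrightarrow> \<bar>x\<bar> \<le> K"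
    and I: "perfect_set I" "I \<noteq> {}" and J: "perfect_set J" and sub: "\<phi> ` I \<subseteq> J"
  shows symbol_composition_schwartz: "f \<in> schwartz J \<Longrightarrow> composition_operator \<phi> I f \<in> schwartz I"
    and symbol_composition_continuous: "continuous_linear_map J I (composition_operator \<phi> I)"
proof -
  note bound = symbol_composition_bound[OF \<phi> proper I(1) J sub]
  have smooth: "smooth_on UNIV \<phi>" using \<phi> by (simp add: schwartz_symbol_def)
  show *: "f \<in> schwartz J \<Longrightarrow> composition_operator \<phi> I f \<in> schwartz I" for f
  proof -
    assume f: "f \<in> schwartz J"
    have "smooth_on I (composition_operator \<phi> I f)"
      by (rule smooth_on_cong[OF I(1) smooth_on_compose[OF I(1) J schwartz_smooth[OF f] smooth sub]])
        (simp add: composition_operator_def)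
    moreover have "bdd_above (schwartz_values I n (composition_operator \<phi> I f))" for n
      using bound[of n] f unfolding bdd_above_def schwartz_values_def by fast
    ultimately show ?thesis
      by (simp add: schwartz_def composition_operator_def)
  qed
  have "J \<noteq> {}" using I(2) sub by auto
  moreover have "\<exists>m C. \<forall>f\<in>schwartz J. schwartz_seminorm I n (composition_operator \<phi> I f)
      \<le> C * schwartz_seminorm J m f" for n
    using bound[of n] schwartz_seminorm_le[OF I(2)] by meson
  ultimately show "continuous_linear_map J I (composition_operator \<phi> I)"
    unfolding continuous_linear_map_def
    by (intro conjI continuous_map_schwartz I J *) (auto simp: composition_operator_def fun_eq_iff)
qed

subsection \<open>Truncation and monotone tails\<close>

lemma nth_deriv_on_mult_bound:
  assumes I: "perfect_set I" "smooth_on I f" "smooth_on I g" "x \<in> I"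
    and f: "\<And>i. i \<le> n \<Longrightarrow> \<bar>nth_deriv_on I i f x\<bar> \<le> A" and g: "\<And>i. i \<le> n \<Longrightarrow> \<bar>nth_deriv_on I i g x\<bar> \<le> B"
  shows "\<bar>nth_deriv_on I n (\<lambda>x. f x * g x) x\<bar> \<le> 2 ^ n * (A * B)"
proof -
  have A: "A \<ge> 0" using f[of 0] by simp
  have "\<bar>nth_deriv_on I n (\<lambda>x. f x * g x) x\<bar> \<le>
      (\<Sum>k\<le>n. \<bar>of_nat (n choose k) * (nth_deriv_on I k f x * nth_deriv_on I (n - k) g x)\<bar>)"
    unfolding nth_deriv_on_mult[OF I] by (rule sum_abs)
  also have "\<dots> \<le> (\<Sum>k\<le>n. of_nat (n choose k) * (A * B))"
    unfolding abs_mult by (intro sum_mono mult_mono f g A) auto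
  also have "\<dots> = 2 ^ n * (A * B)"
    by (simp flip: sum_distrib_right of_nat_sum add: choose_row_sum)
  finally show ?thesis .
qed

lemma schwartz_mult:
  assumes I: "perfect_set I" and h: "smooth_on I h"
    and hb: "\<And>i. \<exists>K. \<forall>x\<in>I. \<bar>nth_deriv_on I i h x\<bar> \<le> K" and f: "f \<in> schwartz I"
  shows "(\<lambda>x. h x * f x) \<in> schwartz I"
  unfolding schwartz_iff
proof (intro conjI allI impI)
  show "smooth_on I (\<lambda>x. h x * f x)"
    by (intro smooth_on_mult I h schwartz_smooth f)
  fix n j
  obtain K where K: "\<And>i x. x \<in> I \<Longrightarrow> \<bar>nth_deriv_on I i h x\<bar> \<le> K i" using hb by metis
  \<comment> \<open>One seminorm index controls both the weight and the order, hence the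
    maximum.\<close>
  let ?A = "\<Sum>i\<le>j. \<bar>K i\<bar>" and ?Q = "schwartz_seminorm I (max n j) f"
  have "(1 + x\<^sup>2) ^ n * \<bar>nth_deriv_on I j (\<lambda>x. h x * f x) x\<bar> \<le> 2 ^ j * (?A * ?Q)" if x: "x \<in> I" for x
  proof -
    define w where "w = (1 + x\<^sup>2) ^ max n j"
    have w: "w > 0" by (simp add: w_def weight_pos)
    have Q0: "?Q \<ge> 0" by (rule schwartz_seminorm_nonneg[OF f]) (use x in auto)
    have "\<bar>K i\<bar> \<le> ?A" if "i \<le> j" for i
      using that by (intro member_le_sum) auto
    then have A: "\<bar>nth_deriv_on I i h x\<bar> \<le> ?A" if "i \<le> j" for i
      using K[OF x, of i] that abs_ge_self[of "K i"] by fastforce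
    have "\<bar>nth_deriv_on I i f x\<bar> \<le> ?Q / w" if "i \<le> j" for i
      using schwartz_seminorm_ge[OF f x, of i "max n j"] that w
      by (simp add: pos_le_divide_eq mult.commute w_def)
    then have "\<bar>nth_deriv_on I j (\<lambda>x. h x * f x) x\<bar> \<le> 2 ^ j * (?A * (?Q / w))"
      by (intro nth_deriv_on_mult_bound I h schwartz_smooth f x A)
    then have "(1 + x\<^sup>2) ^ n * \<bar>nth_deriv_on I j (\<lambda>x. h x * f x) x\<bar> \<le> w * (2 ^ j * (?A * (?Q / w)))"
      using w unfolding w_def by (intro mult_mono weight_mono) auto
    also have "\<dots> = 2 ^ j * (?A * ?Q)" using w by simp
    finally show ?thesis .
  qed
  then show "\<exists>C. \<forall>x\<in>I. (1 + x\<^sup>2) ^ n * \<bar>nth_deriv_on I j (\<lambda>x. h x * f x) x\<bar> \<le> C" by blast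
qed (use schwartz_zero[OF f] in simp)

text \<open>The bound is uniform in the shift \<open>d\<close>, as needed when the truncation point
  moves to infinity.\<close>

lemma bounded_nth_deriv_smooth_step_affine:
  "\<exists>K. \<forall>d x. \<bar>nth_deriv_on UNIV i (\<lambda>x. smooth_step (c * x + d)) x\<bar> \<le> K"
proof -
  obtain K where "\<And>x. \<bar>nth_deriv_on UNIV i smooth_step x\<bar> \<le> K"
    using bounded_nth_deriv_smooth_step by meson
  then have "\<bar>nth_deriv_on UNIV i (\<lambda>x. smooth_step (c * x + d)) x\<bar> \<le> \<bar>c\<bar> ^ i * K" for d x
    unfolding smooth_on_affine(2)[OF smooth_on_smooth_step] abs_mult power_abs
    by (intro mult_left_mono) auto
  then show ?thesis by blast
qed

lemma schwartz_mult_smooth_step: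
  assumes I: "perfect_set I" and f: "f \<in> schwartz I"
  shows "(\<lambda>x. smooth_step (c * x + d) * f x) \<in> schwartz I"
proof (rule schwartz_mult[OF I _ _ f])
  note s = smooth_on_affine(1)[OF smooth_on_smooth_step, of c d]
  show "smooth_on I (\<lambda>x. smooth_step (c * x + d))"
    by (rule smooth_on_restrict[OF s I])
  show "\<exists>K. \<forall>x\<in>I. \<bar>nth_deriv_on I i (\<lambda>x. smooth_step (c * x + d)) x\<bar> \<le> K" for i
    using bounded_nth_deriv_smooth_step_affine[of i c] nth_deriv_on_restrict[OF s I] by metis
qed

text \<open>Since \<open>g\<close> vanishes on [a, a+1), the zero function on x < a + 1 and
  \<open>g\<close> on x > a agree on the overlap of these open sets, so the derivatives
  glue.\<close>

lemma schwartz_extend_by_0: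
  assumes g: "g \<in> schwartz {a..}" and 0: "\<And>x. x < a + 1 \<Longrightarrow> g x = 0"
  shows "g \<in> schwartz UNIV"
proof -
  let ?I = "{a..}"
  have I: "perfect_set ?I" by (rule perfect_set_half_line) (auto simp: half_line_def)
  define F where "F n x = (if x < a + 1 then 0 else nth_deriv_on ?I n g x)" for n x
  have F: "F n x = nth_deriv_on ?I n g x" if "x > a" for n x
    using nth_deriv_on_eq_0[OF I, of "{..<a + 1}" g x n] 0 that by (auto simp: F_def)
  have "(F n has_field_derivative F (Suc n) x) (at x)" for n x
  proof (cases "x > a")
    case True
    have "at x within ?I = at x"
      using True by (intro at_within_interior) auto
    then have "(nth_deriv_on ?I n g has_field_derivative F (Suc n) x) (at x)"
      using smooth_on_nth_deriv[OF I schwartz_smooth[OF g], of x n] True F[OF True, of "Suc n"] by simp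
    then show ?thesis
      by (rule has_field_derivative_transform_within_open[where S = "{a<..}"]) (use True F in auto)
  next
    case False
    then have "((\<lambda>x. 0) has_field_derivative F (Suc n) x) (at x)"
      by (simp add: F_def)
    then show ?thesis
      by (rule has_field_derivative_transform_within_open[where S = "{..<a + 1}"])
        (use False in \<open>auto simp: F_def\<close>)
  qed
  moreover have "g x = F 0 x" for x using 0 by (simp add: F_def)
  ultimately have *: "smooth_on UNIV g" "\<And>n x. nth_deriv_on UNIV n g x = F n x"
    using smooth_on_sequence[OF perfect_set_UNIV, of g F] by auto
  have "\<exists>C. \<forall>x. (1 + x\<^sup>2) ^ n * \<bar>nth_deriv_on UNIV j g x\<bar> \<le> C" for n j
  proof -
    obtain C where "C \<ge> 0" "\<And>x. x \<in> ?I \<Longrightarrow> (1 + x\<^sup>2) ^ n * \<bar>nth_deriv_on ?I j g x\<bar> \<le> C"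
      using schwartz_bound[OF g] by blast
    then have "(1 + x\<^sup>2) ^ n * \<bar>nth_deriv_on UNIV j g x\<bar> \<le> C" for x
      unfolding *(2) F_def by auto
    then show ?thesis by blast
  qed
  then show ?thesis unfolding schwartz_iff using *(1) by simp
qed

text \<open>The difference to the truncation at \<open>k\<close> lives on \<open>x \<ge> k - 1\<close>, where one power of the
  weight is worth a factor \<open>1 / k\<close>.\<close>

lemma schwartz_truncation_tendsto:
  assumes g: "g \<in> schwartz UNIV"
  shows "(\<lambda>k. schwartz_seminorm UNIV n (\<lambda>x. smooth_step (- x + real k) * g x - g x)) \<longlonglongrightarrow> 0"
proof -
  note U = perfect_set_UNIV
  define h where "h k x = smooth_step ((-1) * x + real k) - 1" for k x
  let ?d = "\<lambda>k x. smooth_step (- x + real k) * g x - g x"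
  have eq: "?d k = (\<lambda>x. h k x * g x)" for k
    by (simp add: h_def algebra_simps fun_eq_iff)
  have step: "smooth_on UNIV (\<lambda>x. smooth_step ((-1) * x + real k))" for k
    by (rule smooth_on_affine(1)[OF smooth_on_smooth_step])
  have h: "smooth_on UNIV (h k)" for k
    using smooth_on_lincomb[OF U step smooth_on_const[OF U], of 1 k "-1" 1] by (simp add: h_def[abs_def])
  have "\<exists>K. \<forall>k x. \<bar>nth_deriv_on UNIV i (h k) x\<bar> \<le> K" for i
  proof -
    obtain K where K: "\<And>d x. \<bar>nth_deriv_on UNIV i (\<lambda>x. smooth_step ((-1) * x + d)) x\<bar> \<le> K"
      using bounded_nth_deriv_smooth_step_affine[of i "-1"] by meson
    have c: "\<bar>nth_deriv_on UNIV i (\<lambda>x. 1) x\<bar> \<le> 1" for x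
      using smooth_on_sequence(2)[OF U, of "\<lambda>x. 1" "\<lambda>n x. if n = 0 then 1 else 0" x i] by auto
    have "\<bar>nth_deriv_on UNIV i (h k) x\<bar> \<le> K + 1" for k x
      unfolding h_def[abs_def] nth_deriv_on_diff[OF U step smooth_on_const[OF U] UNIV_I]
      using K[of "real k" x] c[of x] by linarith
    then show ?thesis by blast
  qed
  then obtain K where K: "\<And>i k x. \<bar>nth_deriv_on UNIV i (h k) x\<bar> \<le> K i" by metis
  define A where "A = (\<Sum>i\<le>n. K i)"
  have K0: "K i \<ge> 0" for i using K[of i 0 0] by linarith
  have A: "K i \<le> A" if "i \<le> n" for i
    unfolding A_def using that K0 by (intro member_le_sum) auto
  have A0: "A \<ge> 0" using A[of 0] K0[of 0] by simp
  let ?Q = "schwartz_seminorm UNIV (Suc n) g"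
  have Q0: "?Q \<ge> 0" by (rule schwartz_seminorm_nonneg[OF g]) simp
  have bound: "schwartz_seminorm UNIV n (?d k) \<le> 2 ^ n * A * ?Q / real k" if k: "k \<ge> 2" for k
  proof (rule schwartz_seminorm_le)
    fix x :: real and j assume j: "j \<le> n"
    show "(1 + x\<^sup>2) ^ n * \<bar>nth_deriv_on UNIV j (?d k) x\<bar> \<le> 2 ^ n * A * ?Q / real k"
    proof (cases "x < real k - 1")
      case True
      have "nth_deriv_on UNIV j (?d k) x = 0"
        by (rule nth_deriv_on_eq_0[OF U, of "{..<real k - 1}"]) (use True in \<open>auto simp: smooth_step_1\<close>)
      then show ?thesis using A0 Q0 by simp
    next
      case False
      define w where "w = (1 + x\<^sup>2)"
      have w: "w > 0" by (simp add: w_def add_pos_nonneg)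
      have D: "\<bar>nth_deriv_on UNIV i g x\<bar> \<le> ?Q / w ^ Suc n" if "i \<le> j" for i
        using schwartz_seminorm_ge[OF g UNIV_I, of i "Suc n" x] that j w
        by (simp add: pos_le_divide_eq mult.commute w_def del: power_Suc)
      have "\<bar>nth_deriv_on UNIV j (\<lambda>x. h k x * g x) x\<bar> \<le> 2 ^ j * (A * (?Q / w ^ Suc n))"
        by (rule nth_deriv_on_mult_bound[OF U h schwartz_smooth[OF g] UNIV_I order_trans[OF K A] D])
          (use j in auto)
      also have "\<dots> \<le> 2 ^ n * (A * (?Q / w ^ Suc n))"
        using j A0 Q0 w by (intro mult_right_mono power_increasing) auto
      finally have "w ^ n * \<bar>nth_deriv_on UNIV j (\<lambda>x. h k x * g x) x\<bar> \<le> w ^ n * (2 ^ n * (A * (?Q / w ^ Suc n)))"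
        using w by (intro mult_left_mono) auto
      also have "\<dots> = 2 ^ n * A * ?Q / w" using w by simp
      also have "\<dots> \<le> 2 ^ n * A * ?Q / real k"
      proof (rule divide_left_mono)
        \<comment> \<open>(x - 1)^2 \<ge> 0 gives w \<ge> 2 x, and x \<ge> k - 1 gives 2 x \<ge> 2 k
          - 2, which is at least k once k \<ge> 2.\<close>
        have "2 * x \<le> w" using zero_le_power2[of "x - 1"] by (simp add: w_def power2_diff)
        then show "real k \<le> w" using False k by linarith
      qed (use A0 Q0 w k in auto)
      finally show ?thesis unfolding eq w_def .
    qed
  qed simp
  have "?d k \<in> schwartz UNIV" for k
    using schwartz_diff[OF U schwartz_mult_smooth_step[OF U g, of "-1" "real k"] g] by simp
  then have "\<forall>\<^sub>F k in sequentially. 0 \<le> schwartz_seminorm UNIV n (?d k)"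
    by (intro always_eventually allI schwartz_seminorm_nonneg) auto
  moreover have "\<forall>\<^sub>F k in sequentially. schwartz_seminorm UNIV n (?d k) \<le> 2 ^ n * A * ?Q / real k"
    using eventually_ge_at_top[of 2] by eventually_elim (rule bound)
  ultimately show ?thesis
    by (rule tendsto_sandwich[OF _ _ tendsto_const lim_const_over_n])
qed

section \<open>Monotone tails of a surjective function\<close>

lemma connected_nonzero_sign:
  fixes f :: "real \<Rightarrow> real"
  assumes S: "connected S" "continuous_on S f" and nz: "\<And>x. x \<in> S \<Longrightarrow> f x \<noteq> 0"
  shows "(\<forall>x\<in>S. f x > 0) \<or> (\<forall>x\<in>S. f x < 0)"
proof (rule ccontr)
  assume "\<not> ?thesis"
  then obtain x y where xy: "x \<in> S" "f x \<le> 0" "y \<in> S" "f y \<ge> 0" by (auto simp: not_less)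
  have "connected (f ` S)" by (rule connected_continuous_image[OF S(2,1)])
  then have "{f x..f y} \<subseteq> f ` S"
    by (rule connected_contains_Icc) (use xy in auto)
  then have "0 \<in> f ` S" using xy by auto
  with nz show False by auto
qed

text \<open>If \<open>h\<close> decreased on the left tail, both tails would stay above the minimum
  on [-K,K] and \<open>h\<close> could not be onto. So \<open>h\<close> increases there and is at
  most B on (-\<infinity>, K]; a point where it takes the value B + 1 serves as
  \<open>a\<close>.\<close>

lemma surj_increasing_tail:
  fixes h h' :: "real \<Rightarrow> real"
  assumes surj: "surj h" and D: "\<And>x. (h has_field_derivative h' x) (at x)" and K: "K > 0"
    and right: "\<And>x. x \<ge> K \<Longrightarrow> h' x > 0"
    and left: "(\<forall>x\<le>-K. h' x > 0) \<or> (\<forall>x\<le>-K. h' x < 0)"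
  shows "\<exists>a>K. \<forall>x<a. h x < h a"
proof -
  have cont: "continuous_on S h" for S
    using D DERIV_isCont continuous_at_imp_continuous_on by blast
  have "compact (h ` {-K..K})"
    by (intro compact_continuous_image cont) auto
  then obtain B where B: "\<And>x. x \<in> {-K..K} \<Longrightarrow> \<bar>h x\<bar> \<le> B"
    using compact_imp_bounded by (fastforce simp: bounded_iff)
  have R: "h x < h y" if "K \<le> x" "x < y" for x y
    using DERIV_pos_imp_increasing[OF that(2), of h] D right that by fastforce
  have L: "\<forall>x\<le>-K. h' x > 0"
  proof (rule ccontr)
    assume "\<not> ?thesis"
    then have neg: "\<And>x. x \<le> -K \<Longrightarrow> h' x < 0" using left by blast
    obtain x where x: "h x = - B - 1" using surj by (metis surjD)
    have "h x \<ge> - B"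
    proof -
      consider "x < -K" | "x \<in> {-K..K}" | "x > K" by fastforce
      then show ?thesis
      proof cases
        case 1
        then have "h (-K) < h x"
          using DERIV_neg_imp_decreasing[OF 1, of h] D neg by fastforce
        then show ?thesis using B[of "-K"] K by force
      next
        case 2
        then show ?thesis using B[of x] by linarith
      next
        case 3
        then show ?thesis using R[of K x] B[of K] K by force
      qed
    qed
    with x show False by simp
  qed
  have low: "h x \<le> B" if "x \<le> K" for x
  proof (cases "x < -K")
    case True
    then have "h x < h (-K)"
      using DERIV_pos_imp_increasing[OF True, of h] D L by fastforce
    then show ?thesis using B[of "-K"] K by force
  qed (use B[of x] that in auto)
  obtain a where a: "h a = B + 1" using surj by (metis surjD)
  have "a > K" using low[of a] a by linarith
  moreover have "h x < h a" if "x < a" for x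
    using low[of x] R[of x a] a that by (cases "x \<le> K") auto
  ultimately show ?thesis by blast
qed

subsection \<open>Surjectivity of the composition operator\<close>

text \<open>The sign \<open>s\<close> makes \<open>s * \<phi>\<close> increasing on the tail, so
  both orientations are handled at once. Starting at a - 1 leaves an open neighbourhood of the
  endpoint, and \<open>below\<close> keeps values from x < a out of the image of the tail.\<close>

locale monotone_tail =
  fixes \<phi> :: "real \<Rightarrow> real" and a s :: real
  assumes smooth: "smooth_on UNIV \<phi>" and surj: "surj \<phi>" and s: "s = 1 \<or> s = - 1"
    and deriv_pos: "\<And>x. x > a - 1 \<Longrightarrow> s * nth_deriv_on UNIV 1 \<phi> x > 0"
    and below: "\<And>x. x < a \<Longrightarrow> s * \<phi> x < s * \<phi> a"
begin

lemma has_derivative: "(\<phi> has_field_derivative nth_deriv_on UNIV 1 \<phi> x) (at x)"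
  by (rule smooth_on_field_derivative[OF perfect_set_UNIV smooth UNIV_I])

lemma deriv_nonzero: "a \<le> x \<Longrightarrow> nth_deriv_on UNIV 1 \<phi> x \<noteq> 0"
  using deriv_pos[of x] by auto

lemma scaled_strict_mono: "a - 1 < x \<Longrightarrow> x < y \<Longrightarrow> s * \<phi> x < s * \<phi> y"
  using DERIV_pos_imp_increasing[of x y "\<lambda>x. s * \<phi> x"] DERIV_cmult[OF has_derivative, of s] deriv_pos
  by (metis less_le_trans)

lemma inj_tail: "inj_on \<phi> {a - 1<..}"
  by (rule linorder_inj_onI') (use scaled_strict_mono in fastforce)

lemma le_imp_ge: "s * \<phi> a \<le> s * \<phi> x \<Longrightarrow> a \<le> x"
  using below[of x] by (meson not_le)

lemma scaled_less_iff: "a - 1 < x \<Longrightarrow> a - 1 < y \<Longrightarrow> s * \<phi> x < s * \<phi> y \<longleftrightarrow> x < y"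
  using scaled_strict_mono by (metis less_asym linorder_neqE_linordered_idom order_less_irrefl)

abbreviation I where "I \<equiv> {a..}"
abbreviation J where "J \<equiv> \<phi> ` {a..}"

text \<open>Surjectivity provides a preimage of every value beyond \<phi>(a), and
  \<open>below\<close> forces that preimage into the tail.\<close>

lemma range_eq: "J = {t. s * \<phi> a \<le> s * t}"
proof
  show "J \<subseteq> {t. s * \<phi> a \<le> s * t}"
    using scaled_strict_mono[of a] by (force simp: le_less)
  show "{t. s * \<phi> a \<le> s * t} \<subseteq> J"
  proof
    fix t assume "t \<in> {t. s * \<phi> a \<le> s * t}"
    moreover obtain x where "t = \<phi> x" using surj by (metis surjD)
    ultimately show "t \<in> J" using le_imp_ge[of x] by auto
  qed
qed

lemma half_line_I: "half_line I"
  by (auto simp: half_line_def)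

lemma half_line_J: "half_line J"
proof -
  have "J = {\<phi> a..} \<or> J = {..\<phi> a}"
    unfolding range_eq using s by auto
  then show ?thesis unfolding half_line_def by blast
qed

lemma perfect_I: "perfect_set I" and perfect_J: "perfect_set J"
  by (simp_all only: perfect_set_half_line half_line_I half_line_J)

lemma value_in_range_iff: "\<phi> x \<in> J \<longleftrightarrow> a \<le> x"
  using le_imp_ge[of x] by (auto simp: range_eq) (metis scaled_strict_mono diff_less_eq less_add_one le_less order_refl)

lemma proper: "\<exists>K. \<forall>x\<in>I. \<bar>\<phi> x\<bar> \<le> L \<longrightarrow> \<bar>x\<bar> \<le> K"
proof -
  \<comment> \<open>The summand |\<phi>(a)| places y in the tail, and |L| + 1 places its value
    beyond all values of modulus at most L.\<close>
  obtain y where y: "\<phi> y = s * (\<bar>L\<bar> + 1 + \<bar>\<phi> a\<bar>)" using surj by (metis surjD)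
  then have sy: "s * \<phi> y = \<bar>L\<bar> + 1 + \<bar>\<phi> a\<bar>" using s by auto
  have sx: "s * \<phi> x \<le> \<bar>\<phi> x\<bar>" for x using s by auto
  have ya: "a \<le> y" using le_imp_ge[of y] sx[of a] sy by linarith
  have "\<bar>x\<bar> \<le> max \<bar>a\<bar> \<bar>y\<bar>" if "x \<in> I" "\<bar>\<phi> x\<bar> \<le> L" for x
  proof -
    have "s * \<phi> x < s * \<phi> y" using sx[of x] sy that by linarith
    then have "x < y" using scaled_less_iff[of x y] that ya by simp
    then show ?thesis using that by auto
  qed
  then show ?thesis by blast
qed

text \<open>Inverting on the open half-line from a - 1 makes the inverse differentiable in the
  two-sided sense even at the endpoint \<phi>(a).\<close>

definition \<psi> :: "real \<Rightarrow> real" where "\<psi> = inv_into {a - 1<..} \<phi>"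

lemma \<psi>_\<phi>: "x > a - 1 \<Longrightarrow> \<psi> (\<phi> x) = x"
  unfolding \<psi>_def by (rule inv_into_f_f[OF inj_tail]) simp

lemma \<phi>_\<psi>: "t \<in> J \<Longrightarrow> \<phi> (\<psi> t) = t"
  and \<psi>_in: "t \<in> J \<Longrightarrow> \<psi> t \<ge> a"
  using \<psi>_\<phi> by auto

lemma \<psi>_has_derivative:
  assumes "x > a - 1"
  shows "(\<psi> has_field_derivative inverse (nth_deriv_on UNIV 1 \<phi> x)) (at (\<phi> x))"
  unfolding has_field_derivative_def
proof (rule has_derivative_inverse_strong[of "{a - 1<..}" x])
  show "continuous_on {a - 1<..} \<phi>"
    by (rule continuous_on_subset[OF smooth_on_continuous[OF smooth]]) simp
  show "(\<phi> has_derivative (*) (nth_deriv_on UNIV 1 \<phi> x)) (at x)"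
    using has_derivative[of x] by (simp only: has_field_derivative_def)
  have "nth_deriv_on UNIV 1 \<phi> x \<noteq> 0" using deriv_pos[OF assms] by auto
  then show "(*) (nth_deriv_on UNIV 1 \<phi> x) \<circ> (*) (inverse (nth_deriv_on UNIV 1 \<phi> x)) = id"
    by (auto simp: fun_eq_iff simp del: nth_deriv_on.simps)
qed (use assms \<psi>_\<phi> in auto)

text \<open>Derivatives of \<open>u \<circ> \<psi>\<close> are again of this form, with \<open>u\<close> replaced by \<open>u' / \<phi>'\<close>.\<close>

definition transport :: "(real \<Rightarrow> real) \<Rightarrow> real \<Rightarrow> real" where
  "transport u x = nth_deriv_on I 1 u x * inverse (nth_deriv_on UNIV 1 \<phi> x)"

lemma smooth_on_transport: "smooth_on I u \<Longrightarrow> smooth_on I (transport u)"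
  unfolding transport_def[abs_def]
  by (intro smooth_on_mult smooth_on_inverse smooth_on_deriv perfect_I
      smooth_on_restrict[OF smooth_on_deriv[OF smooth]])
    (assumption, rule deriv_nonzero, simp)

lemma transport_has_derivative:
  assumes u: "smooth_on I u" and t: "t \<in> J"
  shows "((\<lambda>t. u (\<psi> t)) has_field_derivative transport u (\<psi> t)) (at t within J)"
proof -
  have "(\<psi> has_field_derivative inverse (nth_deriv_on UNIV 1 \<phi> (\<psi> t))) (at t within J)"
  proof (rule has_field_derivative_at_within)
    show "(\<psi> has_field_derivative inverse (nth_deriv_on UNIV 1 \<phi> (\<psi> t))) (at t)"
      using \<psi>_has_derivative[of "\<psi> t"] \<psi>_in[OF t] unfolding \<phi>_\<psi>[OF t] by linarith
  qed
  moreover have "\<psi> ` J \<subseteq> I"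
    using \<psi>_in by fastforce
  then have "(u has_field_derivative nth_deriv_on I 1 u (\<psi> t)) (at (\<psi> t) within \<psi> ` J)"
    by (rule has_field_derivative_subset[OF smooth_on_field_derivative[OF perfect_I u], rotated])
      (use \<psi>_in[OF t] in simp)
  ultimately show ?thesis
    using DERIV_image_chain[of u _ \<psi> t J] unfolding o_def transport_def by blast
qed

lemma smooth_on_pullback: "smooth_on I u \<Longrightarrow> smooth_on J (\<lambda>t. u (\<psi> t))"
  by (rule smooth_on_family(1)[OF perfect_J, where \<F> = "{(\<lambda>t. u (\<psi> t)) |u. smooth_on I u}"])
    (use transport_has_derivative smooth_on_transport in fast)+

text \<open>Vanishing near \<open>a\<close> makes the extension by 0 smooth across \<phi>(a), and
  vanishing beyond \<open>c\<close> reduces all weighted bounds to continuity on [a,c]. Both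
  properties survive \<open>transport\<close>, so these functions form a family closed under
  differentiation.\<close>

lemma compact_support_pullback_schwartz:
  assumes u: "smooth_on I u" "\<And>x. a \<le> x \<Longrightarrow> x < a + 1 \<Longrightarrow> u x = 0" "\<And>x. x > c \<Longrightarrow> u x = 0"
  shows "(\<lambda>t. if t \<in> J then u (\<psi> t) else 0) \<in> schwartz UNIV"
proof -
  let ?supp = "\<lambda>u. smooth_on I u \<and> (\<forall>x. a \<le> x \<and> x < a + 1 \<longrightarrow> u x = 0) \<and> (\<forall>x\<ge>a. x > c \<longrightarrow> u x = 0)"
  let ?E = "\<lambda>u t. if t \<in> J then u (\<psi> t) else 0"
  show ?thesis
  proof (rule schwartz_family[OF perfect_set_UNIV, where \<F> = "{?E u | u. ?supp u}"])
    show "?E u \<in> {?E u | u. ?supp u}" using u by blast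
  next
    fix f assume "f \<in> {?E u | u. ?supp u}"
    then obtain u where f: "f = ?E u" and u: "?supp u" by blast
    have "nth_deriv_on I 1 u x = 0" if "a \<le> x" "x < a + 1 \<or> x > c" for x
      by (rule nth_deriv_on_eq_0[OF perfect_I, of "{..<a + 1} \<union> {c<..}"]) (use u that in auto)
    then have supp: "?supp (transport u)"
      using smooth_on_transport u by (auto simp: transport_def simp del: nth_deriv_on.simps)
    \<comment> \<open>Two overlapping open sets cover the line: the interior of \<open>J\<close>,
      where the pullback rule applies, and the values before \<phi>(a + 1), where the function is
      0.\<close>
    have "(?E u has_field_derivative ?E (transport u) t) (at t)" for t
    proof (cases "s * \<phi> a < s * t")
      case True
      have op: "open {t. s * \<phi> a < s * t}" by (intro open_Collect_less continuous_intros)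
      have sub: "{t. s * \<phi> a < s * t} \<subseteq> J" by (auto simp: range_eq)
      have "at t within J = at t"
        using True op sub by (intro at_within_interior) (auto simp: interior_maximal intro!: subsetD[OF interior_maximal[OF sub op]])
      moreover have "t \<in> J" using True sub by blast
      ultimately have "((\<lambda>t. u (\<psi> t)) has_field_derivative ?E (transport u) t) (at t)"
        using transport_has_derivative[of u t] u by simp
      then show ?thesis
        by (rule has_field_derivative_transform_within_open[OF _ op]) (use True sub in auto)
    next
      case False
      have op: "open {t. s * t < s * \<phi> (a + 1)}" by (intro open_Collect_less continuous_intros)
      have t: "s * t < s * \<phi> (a + 1)"
        using False scaled_strict_mono[of a "a + 1"] by simp
      have z: "?E v t = 0" if "s * t < s * \<phi> (a + 1)" "?supp v" for v t
      proof (cases "t \<in> J")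
        case True
        then have "\<psi> t < a + 1" "\<psi> t \<ge> a"
          using \<psi>_in[OF True] \<phi>_\<psi>[OF True] that(1) scaled_less_iff[of "\<psi> t" "a + 1"] by auto
        then show ?thesis using that(2) by auto
      qed simp
      have "((\<lambda>t. 0) has_field_derivative ?E (transport u) t) (at t)"
        using z[OF t supp] by simp
      then show ?thesis
        by (rule has_field_derivative_transform_within_open[OF _ op]) (use t z u in auto)
    qed
    then show "\<exists>g\<in>{?E u | u. ?supp u}. \<forall>t\<in>UNIV. (f has_field_derivative g t) (at t)"
      unfolding f using supp by (intro bexI[of _ "?E (transport u)"]) blast+
  next
    fix f n assume "f \<in> {?E u | u. ?supp u}"
    then obtain u where f: "f = ?E u" and u: "?supp u" by blast
    have "compact ((\<lambda>x. (1 + (\<phi> x)\<^sup>2) ^ n * \<bar>u x\<bar>) ` {a..c})"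
      by (intro compact_continuous_image continuous_intros
          continuous_on_subset[OF smooth_on_continuous[OF smooth]]
          continuous_on_subset[OF smooth_on_continuous, of I u]) (use u in auto)
    then obtain B where B: "\<And>x. x \<in> {a..c} \<Longrightarrow> (1 + (\<phi> x)\<^sup>2) ^ n * \<bar>u x\<bar> \<le> B"
      using compact_imp_bounded by (fastforce simp: bounded_iff)
    have "(1 + t\<^sup>2) ^ n * \<bar>?E u t\<bar> \<le> \<bar>B\<bar>" for t
    proof (cases "t \<in> J \<and> \<psi> t \<le> c")
      case True
      then show ?thesis
        using B[of "\<psi> t"] \<phi>_\<psi>[of t] \<psi>_in[of t] by auto
    next
      case False
      then have "?E u t = 0" using u \<psi>_in[of t] by auto
      then show ?thesis by simp
    qed
    then show "\<exists>C. \<forall>t\<in>UNIV. (1 + t\<^sup>2) ^ n * \<bar>f t\<bar> \<le> C"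
      unfolding f by blast
  qed simp
qed

text \<open>\<phi>(x) lies in \<open>J\<close> only for x \<ge> a, so composing on the whole line
  creates no second copy of \<open>u\<close> elsewhere.\<close>

lemma composition_pullback:
  assumes "\<And>x. x < a \<Longrightarrow> u x = 0"
  shows "composition_operator \<phi> UNIV (\<lambda>t. if t \<in> J then u (\<psi> t) else 0) = u"
proof
  fix x
  show "composition_operator \<phi> UNIV (\<lambda>t. if t \<in> J then u (\<psi> t) else 0) x = u x"
    using assms[of x] \<psi>_\<phi>[of x] value_in_range_iff[of x]
    by (auto simp: composition_operator_def simp del: image_eqI)
qed

text \<open>Closed range takes the place of growth estimates for the inverse: it yields a Schwartz
  function \<open>f1\<close> on the line that equals the pullback on a far tail \<open>V\<close>,
  and the rest of \<open>J\<close> lies in the image of a compact interval.\<close>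

lemma pullback_schwartz:
  assumes closed: "closedin (schwartz_topology UNIV) (composition_operator \<phi> UNIV ` schwartz UNIV)"
    and g: "g \<in> schwartz I"
  shows "(\<lambda>t. if t \<in> J then g (\<psi> t) else 0) \<in> schwartz J"
proof -
  \<comment> \<open>The step rises between a + 1 and a + 2: below, it leaves the gap needed for
    extension by 0; above, \<open>g1\<close> equals \<open>g\<close>, which explains a + 2 in
    \<open>V\<close>.\<close>
  define g1 where "g1 x = smooth_step (1 * x + (- a - 1)) * g x" for x
  have g1_I: "g1 \<in> schwartz I"
    unfolding g1_def by (rule schwartz_mult_smooth_step[OF perfect_I g])
  have g1_0: "g1 x = 0" if "x < a + 1" for x
    using that by (simp add: g1_def smooth_step_0)
  have g1: "g1 \<in> schwartz UNIV"
    by (rule schwartz_extend_by_0[OF g1_I g1_0])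
  \<comment> \<open>The truncations vanish before a + 1 and beyond k, so their pullbacks are
    Schwartz and they lie in the range.\<close>
  have "(\<lambda>x. smooth_step (- x + real k) * g1 x) \<in> composition_operator \<phi> UNIV ` schwartz UNIV" for k
  proof -
    let ?u = "\<lambda>x. smooth_step ((-1) * x + real k) * g1 x"
    have "(\<lambda>t. if t \<in> J then ?u (\<psi> t) else 0) \<in> schwartz UNIV"
      by (rule compact_support_pullback_schwartz[where c = "real k",
            OF schwartz_smooth[OF schwartz_mult_smooth_step[OF perfect_I g1_I]]])
        (auto simp: g1_0 smooth_step_0)
    from imageI[OF this, of "composition_operator \<phi> UNIV"]
    have "?u \<in> composition_operator \<phi> UNIV ` schwartz UNIV"
      by (subst (asm) composition_pullback) (simp_all add: g1_0)
    then show ?thesis unfolding mult_minus1 .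
  qed
  from closedin_schwartz_limit[OF perfect_set_UNIV _ closed this g1 schwartz_truncation_tendsto[OF g1]]
  have "g1 \<in> composition_operator \<phi> UNIV ` schwartz UNIV" by simp
  then obtain f1 where f1: "f1 \<in> schwartz UNIV" and "g1 = composition_operator \<phi> UNIV f1" by blast
  then have f1_g1: "f1 (\<phi> x) = g1 x" for x by (simp add: composition_operator_def)
  let ?f = "\<lambda>t. if t \<in> J then g (\<psi> t) else 0"
  have smooth_f: "smooth_on J ?f"
    by (rule smooth_on_cong[OF perfect_J smooth_on_pullback[OF schwartz_smooth[OF g]]]) auto
  define V where "V = {t. s * \<phi> (a + 2) < s * t}"
  have V: "open V" "V \<subseteq> J"
    using scaled_strict_mono[of a "a + 2"]
    by (auto simp: V_def range_eq intro!: open_Collect_less continuous_intros)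
  have eq: "?f t = f1 t" if "t \<in> V" for t
  proof -
    have t: "t \<in> J" using that V by blast
    have "\<psi> t > a + 2"
      using that \<phi>_\<psi>[OF t] \<psi>_in[OF t] scaled_less_iff[of "a + 2" "\<psi> t"] by (simp add: V_def)
    then have "g1 (\<psi> t) = g (\<psi> t)" by (simp add: g1_def smooth_step_1)
    then show ?thesis using f1_g1[of "\<psi> t"] \<phi>_\<psi>[OF t] t by simp
  qed
  show ?thesis
    unfolding schwartz_iff
  proof (intro conjI allI impI)
    fix n j
    have der: "nth_deriv_on J j ?f t = nth_deriv_on UNIV j f1 t" if "t \<in> V" for t
      by (rule nth_deriv_on_local[OF perfect_J smooth_f schwartz_smooth[OF f1] perfect_set_UNIV V _ eq that]) auto
    obtain C where C: "\<And>t. (1 + t\<^sup>2) ^ n * \<bar>nth_deriv_on UNIV j f1 t\<bar> \<le> C"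
      using schwartz_bound[OF f1] by (metis UNIV_I)
    have "compact ((\<lambda>t. (1 + t\<^sup>2) ^ n * \<bar>nth_deriv_on J j ?f t\<bar>) ` \<phi> ` {a..a + 2})"
      by (intro compact_continuous_image continuous_intros
          continuous_on_subset[OF smooth_on_continuous[OF smooth]]
          continuous_on_subset[OF continuous_on_nth_deriv[OF smooth_f]]) auto
    then obtain B where B: "\<And>x. x \<in> {a..a + 2} \<Longrightarrow> (1 + (\<phi> x)\<^sup>2) ^ n * \<bar>nth_deriv_on J j ?f (\<phi> x)\<bar> \<le> B"
      using compact_imp_bounded by (fastforce simp: bounded_iff)
    have "(1 + t\<^sup>2) ^ n * \<bar>nth_deriv_on J j ?f t\<bar> \<le> max C B" if t: "t \<in> J" for t
    proof (cases "t \<in> V")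
      case True
      then show ?thesis using C[of t] by (simp only: der le_max_iff_disj) simp
    next
      case False
      then have "\<psi> t \<le> a + 2"
        using \<phi>_\<psi>[OF t] \<psi>_in[OF t] scaled_less_iff[of "a + 2" "\<psi> t"] by (simp add: V_def)
      then have "(1 + t\<^sup>2) ^ n * \<bar>nth_deriv_on J j ?f t\<bar> \<le> B"
        using B[of "\<psi> t"] \<phi>_\<psi>[OF t] \<psi>_in[OF t] by simp
      then show ?thesis by (rule max.coboundedI2)
    qed
    then show "\<exists>C. \<forall>t\<in>J. (1 + t\<^sup>2) ^ n * \<bar>nth_deriv_on J j ?f t\<bar> \<le> C" by blast
  qed (use smooth_f in auto)
qed

lemma composition_operator_surj:
  assumes \<phi>: "schwartz_symbol \<phi>"
    and closed: "closedin (schwartz_topology UNIV) (composition_operator \<phi> UNIV ` schwartz UNIV)"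
  shows "composition_operator \<phi> I ` schwartz J = schwartz I"
proof
  show "composition_operator \<phi> I ` schwartz J \<subseteq> schwartz I"
    using symbol_composition_schwartz[OF \<phi> proper perfect_I _ perfect_J] by auto
  show "schwartz I \<subseteq> composition_operator \<phi> I ` schwartz J"
  proof
    fix g assume g: "g \<in> schwartz I"
    have "g = composition_operator \<phi> I (\<lambda>t. if t \<in> J then g (\<psi> t) else 0)"
      using \<psi>_\<phi> schwartz_zero[OF g] by (auto simp: composition_operator_def fun_eq_iff)
    then show "g \<in> composition_operator \<phi> I ` schwartz J"
      using pullback_schwartz[OF closed g] by blast
  qed
qed

end

subsection \<open>Antiderivatives and the multiplication operator\<close>

text \<open>Transfers the existence of antiderivatives from [a, \<infinity>) to half-lines unbounded
  below.\<close>

lemma schwartz_reflect: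
  assumes I: "perfect_set I" "perfect_set (uminus ` I)" and f: "f \<in> schwartz I"
  shows "(\<lambda>x. f (- x)) \<in> schwartz (uminus ` I)"
    and "x \<in> uminus ` I \<Longrightarrow> nth_deriv_on (uminus ` I) n (\<lambda>x. f (- x)) x = (- 1) ^ n * nth_deriv_on I n f (- x)"
proof -
  let ?I = "uminus ` I"
  have "((\<lambda>x. (-1) ^ n * nth_deriv_on I n f (- x)) has_field_derivative (-1) ^ Suc n * nth_deriv_on I (Suc n) f (- x))
      (at x within ?I)" if "x \<in> ?I" for n x
  proof -
    have "uminus ` ?I = I" by (simp add: image_image)
    then have "(nth_deriv_on I n f has_field_derivative nth_deriv_on I (Suc n) f (- x)) (at (- x) within uminus ` ?I)"
      using smooth_on_nth_deriv[OF I(1) schwartz_smooth[OF f], of "- x" n] that by auto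
    moreover have "(uminus has_field_derivative -1) (at x within ?I)"
      by (auto intro!: derivative_eq_intros)
    ultimately have "((\<lambda>x. nth_deriv_on I n f (- x)) has_field_derivative nth_deriv_on I (Suc n) f (- x) * (-1)) (at x within ?I)"
      using DERIV_image_chain unfolding o_def by blast
    from DERIV_cmult[OF this, of "(-1) ^ n"] show ?thesis by simp
  qed
  note * = smooth_on_sequence[OF I(2), of "\<lambda>x. f (- x)" "\<lambda>n x. (-1) ^ n * nth_deriv_on I n f (- x)", OF _ this]
  show D: "nth_deriv_on ?I n (\<lambda>x. f (- x)) x = (- 1) ^ n * nth_deriv_on I n f (- x)" if "x \<in> ?I" for n x
    using *(2) that by simp
  show "(\<lambda>x. f (- x)) \<in> schwartz ?I"
    unfolding schwartz_iff
  proof (intro conjI allI impI)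
    show "smooth_on ?I (\<lambda>x. f (- x))" using *(1) by simp
    fix n j
    obtain C where C: "\<And>x. x \<in> I \<Longrightarrow> (1 + x\<^sup>2) ^ n * \<bar>nth_deriv_on I j f x\<bar> \<le> C"
      using schwartz_bound[OF f] by metis
    have "(1 + x\<^sup>2) ^ n * \<bar>nth_deriv_on ?I j (\<lambda>x. f (- x)) x\<bar> \<le> C" if "x \<in> ?I" for x
      using C[of "- x"] that D[OF that] by (auto simp: abs_mult power_abs simp del: nth_deriv_on.simps)
    then show "\<exists>C. \<forall>x\<in>?I. (1 + x\<^sup>2) ^ n * \<bar>nth_deriv_on ?I j (\<lambda>x. f (- x)) x\<bar> \<le> C" by blast
  next
    fix x assume "x \<notin> ?I"
    then have "- x \<notin> I" by force
    then show "f (- x) = 0" by (rule schwartz_zero[OF f])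
  qed
qed

text \<open>The bound on \<open>g\<close> by \<open>C (1 + t\<^sup>2)\<^sup>-\<^sup>(\<^sup>n\<^sup>+\<^sup>1\<^sup>)\<close> is at most \<open>C (1 + x\<^sup>2)\<^sup>-\<^sup>n (1 + t\<^sup>2)\<^sup>-\<^sup>1\<close> for \<open>t \<ge> x \<ge> 0\<close>,
  whose antiderivative is a multiple of \<open>arctan\<close>.\<close>

lemma antiderivative_increment_bound:
  fixes G g :: "real \<Rightarrow> real"
  assumes D: "\<And>t. t \<ge> x \<Longrightarrow> (G has_field_derivative g t) (at t)" and x: "0 \<le> x" "x \<le> y"
    and g: "\<And>t. t \<ge> x \<Longrightarrow> (1 + t\<^sup>2) ^ Suc n * \<bar>g t\<bar> \<le> C"
  shows "(1 + x\<^sup>2) ^ n * \<bar>G y - G x\<bar> \<le> C * (arctan y - arctan x)"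
proof -
  define w where "w = (1 + x\<^sup>2) ^ n"
  have w: "w > 0" by (simp add: w_def weight_pos)
  have wg: "w * \<bar>g t\<bar> \<le> C * inverse (1 + t\<^sup>2)" if t: "t \<ge> x" for t
  proof -
    have p: "1 + t\<^sup>2 > 0" by (simp add: add_pos_nonneg)
    have "w \<le> (1 + t\<^sup>2) ^ n"
      unfolding w_def using t x by (intro power_mono add_left_mono) auto
    then have "w * \<bar>g t\<bar> * (1 + t\<^sup>2) \<le> (1 + t\<^sup>2) ^ n * \<bar>g t\<bar> * (1 + t\<^sup>2)"
      using p by (intro mult_right_mono) auto
    also have "\<dots> \<le> C" using g[OF t] by (simp add: mult_ac)
    finally show ?thesis using p by (simp add: field_simps)
  qed
  \<comment> \<open>Both signs of \<open>e\<close> are needed: monotonicity of C arctan + w G and of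
    C arctan - w G together bounds the absolute increment.\<close>
  have mono: "C * arctan x + e * (w * G x) \<le> C * arctan y + e * (w * G y)" if e: "\<bar>e\<bar> = 1" for e
  proof (rule DERIV_nonneg_imp_nondecreasing[OF x(2)])
    fix t assume t: "x \<le> t" "t \<le> y"
    have "((\<lambda>t. C * arctan t + e * (w * G t)) has_field_derivative C * inverse (1 + t\<^sup>2) + e * (w * g t)) (at t)"
      by (intro DERIV_add DERIV_cmult DERIV_arctan D t)
    moreover have "\<bar>e * (w * g t)\<bar> = w * \<bar>g t\<bar>" using e w by (simp add: abs_mult)
    then have "0 \<le> C * inverse (1 + t\<^sup>2) + e * (w * g t)"
      using wg[OF t(1)] by linarith
    ultimately show "\<exists>y. ((\<lambda>t. C * arctan t + e * (w * G t)) has_field_derivative y) (at t) \<and> 0 \<le> y" by blast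
  qed
  have "w * \<bar>G y - G x\<bar> = \<bar>w * G y - w * G x\<bar>"
    using w by (simp add: abs_mult flip: right_diff_distrib)
  also have "\<dots> \<le> C * (arctan y - arctan x)"
    using mono[of 1] mono[of "-1"] by (simp add: right_diff_distrib abs_le_iff)
  finally show ?thesis by (simp add: w_def)
qed

text \<open>An antiderivative can decay only if it tends to 0 at infinity, so the integral from
  \<open>a\<close> is corrected by its limit \<open>L\<close>. The decay of \<open>g\<close> gives
  the existence of \<open>L\<close> and the decay of the difference.\<close>

lemma schwartz_antiderivative_atLeast:
  assumes g: "g \<in> schwartz {a..}"
  shows "\<exists>G\<in>schwartz {a..}. \<forall>x\<in>{a..}. nth_deriv_on {a..} 1 G x = g x"
proof -
  let ?I = "{a..}"
  have I: "perfect_set ?I" by (rule perfect_set_half_line) (auto simp: half_line_def)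
  define G0 where "G0 x = integral {a..x} g" for x
  have D: "(G0 has_field_derivative g x) (at x within ?I)" if x: "x \<in> ?I" for x
  proof -
    have "(G0 has_vector_derivative g x) (at x within {a..x + 1})"
      unfolding G0_def
      by (rule integral_has_vector_derivative)
        (use x in \<open>auto intro: continuous_on_subset[OF smooth_on_continuous[OF schwartz_smooth[OF g]]]\<close>)
    moreover have "at x within {a..x + 1} = at x within ?I"
      by (rule at_within_nhd[of _ "{..<x + 1}"]) auto
    ultimately show ?thesis by (simp add: has_real_derivative_iff_has_vector_derivative)
  qed
  \<comment> \<open>Beyond \<open>p\<close> points are positive, as the increment bound requires,
    and interior to the half-line, so derivatives are two-sided.\<close>
  define p where "p = \<bar>a\<bar> + 1"
  have p: "p > 0" "p > a" by (auto simp: p_def)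
  have Dp: "(G0 has_field_derivative g t) (at t)" if "t \<ge> p" for t
    using D[of t] p that at_within_interior[of t ?I] by simp
  have "\<exists>C\<ge>0. \<forall>x\<in>?I. (1 + x\<^sup>2) ^ Suc n * \<bar>g x\<bar> \<le> C" for n
    using schwartz_bound[OF g, of "Suc n" 0] by (metis nth_deriv_on.simps(1))
  then obtain C where C0: "\<And>n. C n \<ge> 0"
    and C: "\<And>n x. x \<in> ?I \<Longrightarrow> (1 + x\<^sup>2) ^ Suc n * \<bar>g x\<bar> \<le> C n" by metis
  have inc: "(1 + x\<^sup>2) ^ n * \<bar>G0 y - G0 x\<bar> \<le> C n * (arctan y - arctan x)" if "p \<le> x" "x \<le> y" for n x y
    by (rule antiderivative_increment_bound[of x G0 g]) (use that p in \<open>auto intro!: Dp C simp del: power_Suc\<close>)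
  \<comment> \<open>For n = 0 the increments are dominated by those of arctan, which converges at
    infinity.\<close>
  have "Cauchy (\<lambda>k. G0 (p + real k))"
  proof (rule CauchyI')
    fix e :: real assume "e > 0"
    have "filterlim (\<lambda>k. p + real k) at_top sequentially"
      by (intro filterlim_tendsto_add_at_top[OF tendsto_const] filterlim_real_sequentially)
    then have "(\<lambda>k. arctan (p + real k)) \<longlonglongrightarrow> pi / 2"
      by (rule filterlim_compose[OF tendsto_arctan_at_top])
    then have "Cauchy (\<lambda>k. arctan (p + real k))" by (rule LIMSEQ_imp_Cauchy)
    then obtain M where M: "\<And>m n. m \<ge> M \<Longrightarrow> n \<ge> M \<Longrightarrow>
        norm (arctan (p + real m) - arctan (p + real n)) < e / (C 0 + 1)"
      using CauchyD[of _ "e / (C 0 + 1)"] \<open>e > 0\<close> C0[of 0] by (metis add_nonneg_pos divide_pos_pos zero_less_one)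
    have "dist (G0 (p + real m)) (G0 (p + real n)) < e" if "m \<ge> M" "m < n" for m n
    proof -
      have "\<bar>G0 (p + real n) - G0 (p + real m)\<bar> \<le> C 0 * (arctan (p + real n) - arctan (p + real m))"
        using inc[of "p + real m" "p + real n" 0] that by simp
      also have "\<dots> \<le> (C 0 + 1) * norm (arctan (p + real n) - arctan (p + real m))"
        using C0[of 0] that by (intro mult_mono) (auto intro: arctan_monotone')
      also have "\<dots> < (C 0 + 1) * (e / (C 0 + 1))"
        using M[of n m] that C0[of 0] by (intro mult_strict_left_mono) auto
      also have "\<dots> = e" using C0[of 0] by simp
      finally show ?thesis by (simp add: dist_real_def abs_minus_commute)
    qed
    then show "\<exists>M. \<forall>m\<ge>M. \<forall>n>m. dist (G0 (p + real m)) (G0 (p + real n)) < e" by blast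
  qed
  then obtain L where L: "(\<lambda>k. G0 (p + real k)) \<longlonglongrightarrow> L"
    using Cauchy_convergent convergent_def by blast
  define G where "G x = (if x \<in> ?I then G0 x - L else 0)" for x
  \<comment> \<open>The derivatives of \<open>G\<close> are those of \<open>g\<close> shifted by
    one, so only the order 0 needs a new decay estimate.\<close>
  define F where "F n = (case n of 0 \<Rightarrow> G | Suc m \<Rightarrow> nth_deriv_on ?I m g)" for n
  have FD: "(F n has_field_derivative F (Suc n) x) (at x within ?I)" if x: "x \<in> ?I" for n x
  proof (cases n)
    case 0
    have "((\<lambda>x. G0 x - L) has_field_derivative g x) (at x within ?I)"
      using DERIV_diff[OF D[OF x] DERIV_const[of L]] by simp
    then have "(G has_field_derivative g x) (at x within ?I)"
      by (rule has_field_derivative_transform_within[OF _ zero_less_one]) (use x in \<open>auto simp: G_def\<close>)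
    then show ?thesis by (simp add: 0 F_def)
  next
    case (Suc m)
    then show ?thesis
      using smooth_on_nth_deriv[OF I schwartz_smooth[OF g] x, of m] by (simp add: F_def)
  qed
  have G: "smooth_on ?I G" "\<And>n x. x \<in> ?I \<Longrightarrow> nth_deriv_on ?I n G x = F n x"
    using smooth_on_sequence[where F = F, OF I _ FD, of G] by (auto simp: F_def)
  have "\<exists>B. \<forall>x\<in>?I. (1 + x\<^sup>2) ^ n * \<bar>nth_deriv_on ?I j G x\<bar> \<le> B" for n j
  proof (cases j)
    case (Suc m)
    obtain B where "\<And>x. x \<in> ?I \<Longrightarrow> (1 + x\<^sup>2) ^ n * \<bar>nth_deriv_on ?I m g x\<bar> \<le> B"
      using schwartz_bound[OF g] by metis
    then have "\<forall>x\<in>?I. (1 + x\<^sup>2) ^ n * \<bar>nth_deriv_on ?I j G x\<bar> \<le> B"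
      using G(2)[of _ j] by (simp add: F_def Suc del: nth_deriv_on.simps)
    then show ?thesis by blast
  next
    case 0
    \<comment> \<open>Lets the upper end p + k of the increment bound tend to infinity; the
      difference \<open>L - G0 x\<close> is then the negative of \<open>G x\<close>.\<close>
    have far: "(1 + x\<^sup>2) ^ n * \<bar>G x\<bar> \<le> C n * pi" if x: "p \<le> x" for x
    proof (rule LIMSEQ_le_const2)
      show "(\<lambda>k. (1 + x\<^sup>2) ^ n * \<bar>G0 (p + real k) - G0 x\<bar>) \<longlonglongrightarrow> (1 + x\<^sup>2) ^ n * \<bar>G x\<bar>"
      proof -
        have "(\<lambda>k. (1 + x\<^sup>2) ^ n * \<bar>G0 (p + real k) - G0 x\<bar>) \<longlonglongrightarrow> (1 + x\<^sup>2) ^ n * \<bar>L - G0 x\<bar>"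
          by (intro tendsto_intros L)
        then show ?thesis using x p by (simp add: G_def abs_minus_commute)
      qed
      obtain N where N: "x \<le> real N" using real_arch_simple by blast
      have "(1 + x\<^sup>2) ^ n * \<bar>G0 (p + real k) - G0 x\<bar> \<le> C n * pi" if "k \<ge> N" for k
      proof -
        have le: "x \<le> p + real k" using N that p by linarith
        have "arctan (p + real k) - arctan x \<le> pi"
          using arctan_ubound[of "p + real k"] arctan_lbound[of x] by linarith
        then have "C n * (arctan (p + real k) - arctan x) \<le> C n * pi"
          by (intro mult_left_mono C0)
        then show ?thesis using inc[OF x le, of n] by linarith
      qed
      then show "\<exists>N. \<forall>k\<ge>N. (1 + x\<^sup>2) ^ n * \<bar>G0 (p + real k) - G0 x\<bar> \<le> C n * pi" by blast
    qed
    have "compact ((\<lambda>x. (1 + x\<^sup>2) ^ n * \<bar>G x\<bar>) ` {a..p})"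
      by (intro compact_continuous_image continuous_intros
          continuous_on_subset[OF smooth_on_continuous[OF G(1)]]) auto
    then obtain B where B: "\<And>x. x \<in> {a..p} \<Longrightarrow> (1 + x\<^sup>2) ^ n * \<bar>G x\<bar> \<le> B"
      using compact_imp_bounded by (fastforce simp: bounded_iff)
    have "(1 + x\<^sup>2) ^ n * \<bar>G x\<bar> \<le> max B (C n * pi)" if "x \<in> ?I" for x
      using B[of x] far[of x] that by (cases "x \<le> p") (auto simp: le_max_iff_disj)
    then show ?thesis using 0 by auto
  qed
  then have "G \<in> schwartz ?I"
    unfolding schwartz_iff using G(1) by (auto simp: G_def)
  moreover have "\<forall>x\<in>?I. nth_deriv_on ?I 1 G x = g x"
    using G(2)[of _ 1] by (simp add: F_def)
  ultimately show ?thesis by blast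
qed

lemma schwartz_antiderivative:
  assumes I: "half_line I" and g: "g \<in> schwartz I"
  shows "\<exists>G\<in>schwartz I. \<forall>x\<in>I. nth_deriv_on I 1 G x = g x"
proof -
  consider a where "I = {a..}" | a where "I = {..a}"
    using I unfolding half_line_def by blast
  then show ?thesis
  proof cases
    case 1
    then show ?thesis using schwartz_antiderivative_atLeast g by simp
  next
    case (2 a)
    let ?K = "{- a..}"
    have K: "uminus ` I = ?K" "uminus ` ?K = I"
      by (auto simp: 2)
    have pK: "perfect_set ?K" by (rule perfect_set_half_line) (auto simp: half_line_def)
    note pI = perfect_set_half_line[OF I]
    have "(\<lambda>x. g (- x)) \<in> schwartz ?K"
      using schwartz_reflect(1)[of I g] pI pK g unfolding K by blast
    then obtain H where H: "H \<in> schwartz ?K" "\<And>x. x \<in> ?K \<Longrightarrow> nth_deriv_on ?K 1 H x = g (- x)"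
      using schwartz_antiderivative_atLeast by blast
    note H' = schwartz_reflect[of ?K H, unfolded K, OF pK pI H(1)]
    \<comment> \<open>The sign undoes the factor -1 produced by reflection; the zero summand only
      brings the function into the shape of a linear combination.\<close>
    have "(\<lambda>x. (- 1) * H (- x) + 0 * H (- x)) \<in> schwartz I"
      by (rule schwartz_lincomb[OF pI H'(1) H'(1)])
    moreover have "nth_deriv_on I 1 (\<lambda>x. (- 1) * H (- x) + 0 * H (- x)) x = g x" if "x \<in> I" for x
      unfolding nth_deriv_on_lincomb[OF pI schwartz_smooth[OF H'(1)] schwartz_smooth[OF H'(1)] that]
        H'(2)[OF that]
      using H(2)[of "- x"] that 2 by simp
    ultimately show ?thesis by blast
  qed
qed

context monotone_tail
begin

lemma nth_deriv_on_composition: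
  assumes A: "smooth_on J A" and x: "x \<in> I"
  shows "nth_deriv_on I 1 (composition_operator \<phi> I A) x = deriv \<phi> x * nth_deriv_on J 1 A (\<phi> x)"
proof -
  have d: "deriv \<phi> x = nth_deriv_on UNIV 1 \<phi> x"
    by (rule DERIV_imp_deriv[OF has_derivative])
  have "(A has_field_derivative nth_deriv_on J 1 A (\<phi> x)) (at (\<phi> x) within \<phi> ` I)"
    by (rule smooth_on_field_derivative[OF perfect_J A]) (use x in auto)
  then have "((\<lambda>x. A (\<phi> x)) has_field_derivative nth_deriv_on J 1 A (\<phi> x) * deriv \<phi> x) (at x within I)"
    using DERIV_image_chain[OF _ has_field_derivative_at_within[OF has_derivative]] unfolding d o_def by blast
  then have "(composition_operator \<phi> I A has_field_derivative nth_deriv_on J 1 A (\<phi> x) * deriv \<phi> x) (at x within I)"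
    by (rule has_field_derivative_transform_within[OF _ zero_less_one x]) (simp add: composition_operator_def)
  then show ?thesis
    using nth_deriv_on_Suc_eq[OF perfect_I x, of 0] by (simp add: mult.commute del: nth_deriv_on.simps(2))
qed

text \<open>Both inclusions come from \<open>(A \<circ> \<phi>)' = \<phi>' (A' \<circ> \<phi>)\<close>, since composition with \<open>\<phi>\<close> and
  differentiation are onto.\<close>

lemma multiplication_operator_deriv:
  assumes \<phi>: "schwartz_symbol \<phi>"
    and onto: "composition_operator \<phi> I ` schwartz J = schwartz I"
  shows "multiplication_operator (deriv \<phi>) ` schwartz I = schwartz I"
proof
  note comp = symbol_composition_schwartz[OF \<phi> proper perfect_I _ perfect_J]
  show "multiplication_operator (deriv \<phi>) ` schwartz I \<subseteq> schwartz I"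
  proof clarify
    fix f assume f: "f \<in> schwartz I"
    then obtain F where F: "F \<in> schwartz J" "f = composition_operator \<phi> I F"
      using onto by blast
    obtain A where A: "A \<in> schwartz J" "\<And>t. t \<in> J \<Longrightarrow> nth_deriv_on J 1 A t = F t"
      using schwartz_antiderivative[OF half_line_J F(1)] by blast
    show "multiplication_operator (deriv \<phi>) f \<in> schwartz I"
    proof (rule schwartz_deriv[OF perfect_I comp[OF _ _ A(1)]])
      fix x assume x: "x \<in> I"
      then show "multiplication_operator (deriv \<phi>) f x = nth_deriv_on I 1 (composition_operator \<phi> I A) x"
        unfolding nth_deriv_on_composition[OF schwartz_smooth[OF A(1)] x]
        unfolding A(2)[OF imageI[OF x]] using x
        by (simp add: multiplication_operator_def F(2) composition_operator_def)
    qed (use schwartz_zero[OF f] in \<open>auto simp: multiplication_operator_def\<close>)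
  qed
  show "schwartz I \<subseteq> multiplication_operator (deriv \<phi>) ` schwartz I"
  proof
    fix g assume g: "g \<in> schwartz I"
    obtain G where G: "G \<in> schwartz I" "\<And>x. x \<in> I \<Longrightarrow> nth_deriv_on I 1 G x = g x"
      using schwartz_antiderivative[OF half_line_I g] by blast
    then obtain H where H: "H \<in> schwartz J" "G = composition_operator \<phi> I H"
      using onto by blast
    define h where "h t = (if t \<in> J then nth_deriv_on J 1 H t else 0)" for t
    have h: "h \<in> schwartz J"
      by (rule schwartz_deriv[OF perfect_J H(1), of _ 1]) (simp_all add: h_def)
    have "g = multiplication_operator (deriv \<phi>) (composition_operator \<phi> I h)"
    proof
      fix x
      show "g x = multiplication_operator (deriv \<phi>) (composition_operator \<phi> I h) x"
      proof (cases "x \<in> I")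
        case True
        then have "g x = deriv \<phi> x * nth_deriv_on J 1 H (\<phi> x)"
          using G(2)[OF True] nth_deriv_on_composition[OF schwartz_smooth[OF H(1)] True] H(2) by simp
        then show ?thesis
          using True by (simp add: multiplication_operator_def composition_operator_def h_def)
      qed (simp add: schwartz_zero[OF g] multiplication_operator_def composition_operator_def)
    qed
    then show "g \<in> multiplication_operator (deriv \<phi>) ` schwartz I"
      using comp[OF _ _ h] by blast
  qed
qed

end

section \<open>Existence of a monotone tail and the conclusion\<close>

text \<open>The derivative is continuous without zeros on each outer half-line, so it has a fixed
  sign there. Choosing \<open>s\<close> to make the right-hand sign positive reduces to
  \<open>surj_increasing_tail\<close>.\<close>

lemma exists_monotone_tail:
  assumes smooth: "smooth_on UNIV \<phi>" and surj: "surj \<phi>" and nz: "\<And>x. \<bar>x\<bar> > k \<Longrightarrow> deriv \<phi> x \<noteq> 0"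
  shows "\<exists>a s. monotone_tail \<phi> a s"
proof -
  let ?d = "nth_deriv_on UNIV 1 \<phi>"
  have D: "(\<phi> has_field_derivative ?d x) (at x)" for x
    by (rule smooth_on_field_derivative[OF perfect_set_UNIV smooth UNIV_I])
  have nz': "?d x \<noteq> 0" if "\<bar>x\<bar> > k" for x
    using nz[OF that] DERIV_imp_deriv[OF D] by metis
  have cont: "continuous_on S ?d" for S
    by (rule continuous_on_subset[OF continuous_on_nth_deriv[OF smooth]]) simp
  define K where "K = \<bar>k\<bar> + 1"
  have right: "(\<forall>x\<in>{K..}. ?d x > 0) \<or> (\<forall>x\<in>{K..}. ?d x < 0)"
    by (rule connected_nonzero_sign[OF _ cont], simp, rule nz') (auto simp: K_def)
  have left: "(\<forall>x\<in>{..-K}. ?d x > 0) \<or> (\<forall>x\<in>{..-K}. ?d x < 0)"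
    by (rule connected_nonzero_sign[OF _ cont], simp, rule nz') (auto simp: K_def)
  obtain s :: real where s: "s = 1 \<or> s = - 1" and pos: "\<And>x. x \<ge> K \<Longrightarrow> s * ?d x > 0"
  proof -
    from right show ?thesis
    proof
      assume "\<forall>x\<in>{K..}. ?d x > 0"
      then show ?thesis by (intro that[of 1]) auto
    next
      assume "\<forall>x\<in>{K..}. ?d x < 0"
      then show ?thesis by (intro that[of "-1"]) auto
    qed
  qed
  \<comment> \<open>K + 1 instead of K, so that a - 1 > K and the sign is known on all of x > a -
    1.\<close>
  have "\<exists>a>K + 1. \<forall>x<a. s * \<phi> x < s * \<phi> a"
  proof (rule surj_increasing_tail[where h' = "\<lambda>x. s * ?d x"])
    show "surj (\<lambda>x. s * \<phi> x)"
    proof (rule surjI)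
      show "s * \<phi> (inv \<phi> (s * y)) = y" for y
        using s by (auto simp: surj_f_inv_f[OF surj])
    qed
    show "((\<lambda>x. s * \<phi> x) has_field_derivative s * ?d x) (at x)" for x
      by (rule DERIV_cmult[OF D])
    show "K + 1 > 0" by (simp add: K_def)
    show "s * ?d x > 0" if "x \<ge> K + 1" for x
      using that by (intro pos) simp
    show "(\<forall>x\<le>-(K + 1). s * ?d x > 0) \<or> (\<forall>x\<le>-(K + 1). s * ?d x < 0)"
      using left s by (auto simp del: nth_deriv_on.simps)
  qed
  then obtain a where a: "a > K + 1" "\<And>x. x < a \<Longrightarrow> s * \<phi> x < s * \<phi> a" by blast
  have "monotone_tail \<phi> a s"
    by unfold_locales (use smooth surj s a pos in auto)
  then show ?thesis by blast
qed

theorem theorem4p9: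
  fixes \<phi> :: "real \<Rightarrow> real"
  assumes "schwartz_symbol \<phi>"
    and "surj \<phi>"
    and "closedin (schwartz_topology UNIV) (composition_operator \<phi> UNIV ` schwartz UNIV)"
    and "\<exists>k. \<forall>x. \<bar>x\<bar> > k \<longrightarrow> deriv \<phi> x \<noteq> 0"
  shows "\<exists>I. half_line I \<and>
    continuous_linear_map (\<phi> ` I) I (composition_operator \<phi> I) \<and>
    composition_operator \<phi> I ` schwartz (\<phi> ` I) = schwartz I \<and>
    (\<forall>f \<in> schwartz I. multiplication_operator (deriv \<phi>) f \<in> schwartz I) \<and>
    closedin (schwartz_topology I) (multiplication_operator (deriv \<phi>) ` schwartz I) \<and>
    (\<exists>n\<le>1. has_codimension (schwartz I) (multiplication_operator (deriv \<phi>) ` schwartz I) n)"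
proof -
  have "smooth_on UNIV \<phi>" using assms(1) by (simp add: schwartz_symbol_def)
  then obtain a s where "monotone_tail \<phi> a s"
    using exists_monotone_tail assms(2,4) by metis
  then interpret monotone_tail \<phi> a s .
  have onto: "composition_operator \<phi> I ` schwartz J = schwartz I"
    by (rule composition_operator_surj[OF assms(1,3)])
  have mult: "multiplication_operator (deriv \<phi>) ` schwartz I = schwartz I"
    by (rule multiplication_operator_deriv[OF assms(1) onto])
  have "continuous_linear_map J I (composition_operator \<phi> I)"
    by (rule symbol_composition_continuous[OF assms(1) proper perfect_I _ perfect_J]) auto
  moreover have "closedin (schwartz_topology I) (schwartz I)"
    using closedin_topspace[of "schwartz_topology I"] topspace_schwartz[OF perfect_I] by simp
  \<comment> \<open>The quotient is trivial and its basis empty; the only coefficient family on the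
    empty index set is the everywhere undefined one.\<close>
  moreover have "has_codimension (schwartz I) (schwartz I) 0"
    unfolding has_codimension_def by (auto simp: PiE_empty_domain)
  ultimately show ?thesis
    using half_line_I onto mult by (intro exI[of _ I]) (auto intro!: exI[of _ 0])
qed

end
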